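(* Let $G=(V,E)$ be a finite graph, $\beta>0$, and let $a,b,c\in V$. Then $$\langle\sigma_a\bar\sigma_b\rangle_{G,\beta}\ \ge\ \langle\sigma_a\bar\sigma_c\rangle_{G,\beta}\,\langle\sigma_c\bar\sigma_b\rangle_{G,\beta}\ \ge\ \langle\sigma_a\sigma_b\bar\sigma_c^2\rangle_{G,\beta}.$$
   Context: XY model: $\langle\cdot\rangle_{G,\beta}$ is the expectation with respect to the probability measure $d\mu_{G,\beta}(\sigma)\propto\exp\big(\tfrac12\beta\sum_{vv'\in E}(\sigma_v\bar\sigma_{v'}+\bar\sigma_v\sigma_{v'})\big)\prod_{v\in V}d\sigma_v$ on $\mathbb S^V$, with $\mathbb S=\{z\in\mathbb C:|z|=1\}$ and $d\sigma_v$ the uniform probability measure on $\mathbb S$. All the correlations appearing are real. *)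

theory Defs
  imports "HOL-Probability.Probability"
begin

definition finite_graph :: "'v set \<Rightarrow> 'v set set \<Rightarrow> bool" where
  "finite_graph V E \<longleftrightarrow> finite V \<and> (\<forall>e\<in>E. \<exists>v\<in>V. \<exists>w\<in>V. v \<noteq> w \<and> e = {v, w})"

definition unif_circle :: "complex measure" where
  "unif_circle =
     distr (uniform_measure lborel {0..2 * pi}) (restrict_space borel (sphere 0 1)) cis"

text \<open>The reference measure \<open>\<Prod>v\<in>V. d\<sigma>\<^sub>v\<close>.
  Its points are the extensional functions from \<open>V\<close> to the unit circle.\<close>

definition spin_measure :: "'v set \<Rightarrow> ('v \<Rightarrow> complex) measure" where
  "spin_measure V = (\<Pi>\<^sub>M v\<in>V. unif_circle)"

text \<open>An edge is an unordered pair, so the two summands of its interaction are obtained by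
  summing over its two orientations.\<close>

definition edge_interaction :: "('v \<Rightarrow> complex) \<Rightarrow> 'v set \<Rightarrow> complex" where
  "edge_interaction \<sigma> e = (\<Sum>(v, w) \<in> {(v, w). {v, w} = e}. \<sigma> v * cnj (\<sigma> w))"

lemma edge_interaction_pair:
  assumes "v \<noteq> w"
  shows "edge_interaction \<sigma> {v, w} = \<sigma> v * cnj (\<sigma> w) + cnj (\<sigma> v) * \<sigma> w"
proof -
  have "{(x, y). {x, y} = {v, w}} = {(v, w), (w, v)}"
    by (auto simp: doubleton_eq_iff)
  with assms show ?thesis
    by (simp add: edge_interaction_def mult.commute)
qed

text \<open>The exponent is real, see \<open>edge_interaction_real\<close>; \<open>Re\<close> only changes its type.\<close>

definition xy_weight :: "'v set set \<Rightarrow> real \<Rightarrow> ('v \<Rightarrow> complex) \<Rightarrow> real" where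
  "xy_weight E \<beta> \<sigma> = exp (1 / 2 * \<beta> * Re (\<Sum>e\<in>E. edge_interaction \<sigma> e))"

definition xy_partition :: "'v set \<Rightarrow> 'v set set \<Rightarrow> real \<Rightarrow> real" where
  "xy_partition V E \<beta> = (\<integral>\<sigma>. xy_weight E \<beta> \<sigma> \<partial>spin_measure V)"

definition xy_measure :: "'v set \<Rightarrow> 'v set set \<Rightarrow> real \<Rightarrow> ('v \<Rightarrow> complex) measure" where
  "xy_measure V E \<beta> =
     density (spin_measure V) (\<lambda>\<sigma>. ennreal (xy_weight E \<beta> \<sigma> / xy_partition V E \<beta>))"

definition xy_expectation ::
    "'v set \<Rightarrow> 'v set set \<Rightarrow> real \<Rightarrow> (('v \<Rightarrow> complex) \<Rightarrow> complex) \<Rightarrow> complex" where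
  "xy_expectation V E \<beta> f = (\<integral>\<sigma>. f \<sigma> \<partial>xy_measure V E \<beta>)"

text \<open>Consistency of the definitions: \<open>xy_measure\<close> is a probability measure
  (\<open>prob_space_xy_measure\<close>), and the correlations
  are real (\<open>xy_correlations_real\<close>), so they can be compared through \<open>Re\<close>.\<close>

lemma cis_measurable_circle:
  "cis \<in> uniform_measure lborel {0..2 * pi} \<rightarrow>\<^sub>M restrict_space borel (sphere 0 1)"
proof -
  have "cis \<in> borel_measurable borel"
    by (intro borel_measurable_continuous_onI continuous_intros)
  then show ?thesis
    by (simp add: measurable_restrict_space2_iff)
qed

lemma prob_space_unif_circle: "prob_space unif_circle"
proof -
  have "prob_space (uniform_measure lborel {0..2 * pi})"
    by (rule prob_space_uniform_measure) auto
  then show ?thesis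
    unfolding unif_circle_def by (rule prob_space.prob_space_distr) (rule cis_measurable_circle)
qed

lemma sets_unif_circle: "sets unif_circle = sets (restrict_space borel (sphere 0 1))"
  and space_unif_circle: "space unif_circle = sphere 0 1"
  by (auto simp: unif_circle_def space_restrict_space)

lemma cnj_measurable_circle: "cnj \<in> unif_circle \<rightarrow>\<^sub>M unif_circle"
proof -
  have "cnj \<in> restrict_space borel (sphere 0 1) \<rightarrow>\<^sub>M restrict_space borel (sphere 0 1)"
    by (rule measurable_restrict_space3) (auto intro!: borel_measurable_continuous_onI continuous_intros)
  then show ?thesis
    by (simp cong: measurable_cong_sets add: sets_unif_circle)
qed

lemma distr_unif_reflect:
  "distr (uniform_measure lborel {0..2 * pi}) borel (\<lambda>t. 2 * pi - t)
     = uniform_measure lborel {0..2 * pi}"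
proof (rule measure_eqI)
  fix A assume "A \<in> sets (distr (uniform_measure lborel {0..2 * pi}) borel (\<lambda>t. 2 * pi - t))"
  then have A: "A \<in> sets borel" by simp
  have l: "lborel = distr lborel borel (\<lambda>t::real. 2 * pi - t)"
    using lborel_real_affine[of "-1" "2 * pi"] by (simp add: density_1)
  have [measurable]: "(\<lambda>t::real. 2 * pi - t) \<in> borel \<rightarrow>\<^sub>M borel" by measurable
  have "emeasure lborel ({0..2 * pi} \<inter> A)
      = emeasure (distr lborel borel (\<lambda>t::real. 2 * pi - t)) ({0..2 * pi} \<inter> A)"
    using l by simp
  also have "\<dots> = emeasure lborel ((\<lambda>t::real. 2 * pi - t) -` ({0..2 * pi} \<inter> A))"
    using A by (subst emeasure_distr) auto
  also have "(\<lambda>t::real. 2 * pi - t) -` ({0..2 * pi} \<inter> A)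
      = {0..2 * pi} \<inter> (\<lambda>t. 2 * pi - t) -` A" by auto
  finally have eq: "emeasure lborel ({0..2 * pi} \<inter> A)
      = emeasure lborel ({0..2 * pi} \<inter> (\<lambda>t. 2 * pi - t) -` A)" .
  have "(\<lambda>t::real. 2 * pi - t) -` A \<in> sets borel"
    using measurable_sets_borel[of "\<lambda>t::real. 2 * pi - t" borel A] A by simp
  then show "emeasure (distr (uniform_measure lborel {0..2 * pi}) borel (\<lambda>t. 2 * pi - t)) A
      = emeasure (uniform_measure lborel {0..2 * pi}) A"
    using A eq by (subst emeasure_distr) auto
qed simp

lemma distr_unif_circle_cnj: "distr unif_circle unif_circle cnj = unif_circle"
proof -
  let ?U = "uniform_measure lborel {0..2 * pi}" and ?S = "restrict_space borel (sphere (0::complex) 1)"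
  have m: "cis \<in> borel \<rightarrow>\<^sub>M ?S"
    using cis_measurable_circle by simp
  have r: "(\<lambda>t. 2 * pi - t) \<in> ?U \<rightarrow>\<^sub>M borel" by simp
  have "unif_circle = distr (distr ?U borel (\<lambda>t. 2 * pi - t)) ?S cis"
    by (simp only: unif_circle_def distr_unif_reflect)
  also have "\<dots> = distr ?U ?S (cis \<circ> (\<lambda>t. 2 * pi - t))"
    by (rule distr_distr[OF m r])
  also have "cis \<circ> (\<lambda>t. 2 * pi - t) = cnj \<circ> cis"
    by (auto simp: fun_eq_iff complex_eq_iff cos_diff sin_diff)
  also have "distr ?U ?S (cnj \<circ> cis) = distr unif_circle ?S cnj"
    unfolding unif_circle_def
    by (rule distr_distr[symmetric, OF _ cis_measurable_circle])
       (use cnj_measurable_circle in \<open>simp add: sets_unif_circle cong: measurable_cong_sets\<close>)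
  also have "\<dots> = distr unif_circle unif_circle cnj"
    by (rule distr_cong) (auto simp: sets_unif_circle)
  finally show ?thesis by simp
qed

lemma prob_space_spin_measure: "prob_space (spin_measure V)"
  unfolding spin_measure_def by (intro prob_space_PiM prob_space_unif_circle)

lemma distr_spin_measure_cnj:
  assumes "finite V"
  shows "distr (spin_measure V) (spin_measure V) (compose V cnj) = spin_measure V"
  unfolding spin_measure_def
  using distr_PiM_finite_prob_space'[OF assms, of "\<lambda>_. unif_circle" "\<lambda>_. unif_circle" cnj]
  by (simp add: distr_unif_circle_cnj prob_space_unif_circle cnj_measurable_circle)

lemma spin_measurable:
  assumes "v \<in> V"
  shows "(\<lambda>\<sigma>. \<sigma> v) \<in> borel_measurable (spin_measure V)"
proof -
  have "(\<lambda>\<sigma>. \<sigma> v) \<in> spin_measure V \<rightarrow>\<^sub>M unif_circle"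
    unfolding spin_measure_def using assms by simp
  then have "(\<lambda>\<sigma>. \<sigma> v) \<in> spin_measure V \<rightarrow>\<^sub>M restrict_space borel (sphere 0 1)"
    by (simp add: sets_unif_circle cong: measurable_cong_sets)
  then show ?thesis by (simp add: measurable_restrict_space2_iff)
qed

lemma norm_spin: "\<sigma> \<in> space (spin_measure V) \<Longrightarrow> v \<in> V \<Longrightarrow> norm (\<sigma> v) = 1"
  by (auto simp: spin_measure_def space_PiM space_unif_circle PiE_iff)

lemma edge_cases:
  assumes "finite_graph V E" "e \<in> E"
  obtains v w where "v \<in> V" "w \<in> V" "v \<noteq> w" "e = {v, w}"
  using assms by (auto simp: finite_graph_def)

lemma finite_edges: "finite_graph V E \<Longrightarrow> finite E"
  by (rule finite_subset[of _ "Pow V"]) (auto simp: finite_graph_def)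

lemma edge_interaction_real:
  assumes "finite_graph V E" "e \<in> E"
  shows "edge_interaction \<sigma> e \<in> \<real>"
  using assms by (elim edge_cases) (auto simp: edge_interaction_pair complex_is_Real_iff)

lemma xy_weight_measurable:
  assumes "finite_graph V E"
  shows "xy_weight E \<beta> \<in> borel_measurable (spin_measure V)"
proof -
  have "(\<lambda>\<sigma>. edge_interaction \<sigma> e) \<in> borel_measurable (spin_measure V)" if "e \<in> E" for e
  proof -
    obtain v w where vw: "v \<in> V" "w \<in> V" "v \<noteq> w" "e = {v, w}"
      using edge_cases[OF assms \<open>e \<in> E\<close>] by blast
    note [measurable] = spin_measurable[OF vw(1)] spin_measurable[OF vw(2)]
    have [measurable]: "cnj \<in> borel_measurable borel"
      by (intro borel_measurable_continuous_onI continuous_intros)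
    show ?thesis
      using vw by (simp add: edge_interaction_pair)
  qed
  then have "(\<lambda>\<sigma>. \<Sum>e\<in>E. edge_interaction \<sigma> e) \<in> borel_measurable (spin_measure V)"
    by (intro borel_measurable_sum)
  moreover have "Re \<in> borel_measurable borel"
    by (intro borel_measurable_continuous_onI continuous_intros)
  ultimately have [measurable]:
    "(\<lambda>\<sigma>. Re (\<Sum>e\<in>E. edge_interaction \<sigma> e)) \<in> borel_measurable (spin_measure V)"
    by (rule measurable_compose)
  show ?thesis unfolding xy_weight_def[abs_def] by measurable
qed

lemma xy_weight_pos: "0 < xy_weight E \<beta> \<sigma>"
  by (simp add: xy_weight_def)

lemma xy_weight_integrable:
  assumes "finite_graph V E"
  shows "integrable (spin_measure V) (xy_weight E \<beta>)"
proof -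
  interpret prob_space "spin_measure V" by (rule prob_space_spin_measure)
  have le: "xy_weight E \<beta> \<sigma> \<le> exp (\<bar>\<beta>\<bar> * real (card E))" if s: "\<sigma> \<in> space (spin_measure V)" for \<sigma>
  proof -
    have "norm (edge_interaction \<sigma> e) \<le> 2" if "e \<in> E" for e
    proof -
      obtain v w where vw: "v \<in> V" "w \<in> V" "v \<noteq> w" "e = {v, w}"
        using edge_cases[OF assms \<open>e \<in> E\<close>] by blast
      show ?thesis
        using norm_triangle_ineq[of "\<sigma> v * cnj (\<sigma> w)" "cnj (\<sigma> v) * \<sigma> w"] vw
        by (simp add: edge_interaction_pair norm_mult norm_spin[OF s])
    qed
    then have "norm (\<Sum>e\<in>E. edge_interaction \<sigma> e) \<le> (\<Sum>e\<in>E. 2)"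
      by (rule sum_norm_le)
    then have r: "\<bar>Re (\<Sum>e\<in>E. edge_interaction \<sigma> e)\<bar> \<le> 2 * real (card E)"
      using abs_Re_le_cmod order_trans by fastforce
    have "1 / 2 * \<beta> * Re (\<Sum>e\<in>E. edge_interaction \<sigma> e)
        \<le> \<bar>1 / 2 * \<beta> * Re (\<Sum>e\<in>E. edge_interaction \<sigma> e)\<bar>" by simp
    also have "\<dots> = 1 / 2 * \<bar>\<beta>\<bar> * \<bar>Re (\<Sum>e\<in>E. edge_interaction \<sigma> e)\<bar>"
      by (simp add: abs_mult)
    also have "\<dots> \<le> 1 / 2 * \<bar>\<beta>\<bar> * (2 * real (card E))"
      using r by (intro mult_left_mono) auto
    finally show ?thesis by (simp add: xy_weight_def)
  qed
  show ?thesis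
    by (rule integrable_const_bound[where B = "exp (\<bar>\<beta>\<bar> * real (card E))"])
       (use le in \<open>auto intro!: AE_I2 xy_weight_measurable assms simp: abs_of_pos xy_weight_pos\<close>)
qed

lemma xy_partition_pos:
  assumes "finite_graph V E"
  shows "0 < xy_partition V E \<beta>"
proof -
  interpret prob_space "spin_measure V" by (rule prob_space_spin_measure)
  show ?thesis
    unfolding xy_partition_def
    by (rule expectation_greater[OF xy_weight_integrable[OF assms]]) (simp add: xy_weight_pos)
qed

lemma prob_space_xy_measure:
  assumes "finite_graph V E"
  shows "prob_space (xy_measure V E \<beta>)"
proof
  let ?w = "\<lambda>\<sigma>. xy_weight E \<beta> \<sigma> / xy_partition V E \<beta>"
  note [measurable] = xy_weight_measurable[OF assms]
  have "emeasure (xy_measure V E \<beta>) (space (xy_measure V E \<beta>)) = (\<integral>\<^sup>+\<sigma>. ennreal (?w \<sigma>) \<partial>spin_measure V)"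
    by (simp add: xy_measure_def emeasure_density cong: nn_integral_cong)
  also have "\<dots> = ennreal (\<integral>\<sigma>. ?w \<sigma> \<partial>spin_measure V)"
    using xy_weight_integrable[OF assms] xy_partition_pos[OF assms] xy_weight_pos[THEN less_imp_le]
    by (intro nn_integral_eq_integral AE_I2 divide_nonneg_pos) auto
  also have "(\<integral>\<sigma>. ?w \<sigma> \<partial>spin_measure V) = 1"
    using xy_partition_pos[OF assms, of \<beta>] by (simp add: xy_partition_def)
  finally show "emeasure (xy_measure V E \<beta>) (space (xy_measure V E \<beta>)) = 1" by simp
qed

lemma xy_weight_compose_cnj:
  assumes "finite_graph V E"
  shows "xy_weight E \<beta> (compose V cnj \<sigma>) = xy_weight E \<beta> \<sigma>"
proof -
  have "edge_interaction (compose V cnj \<sigma>) e = edge_interaction \<sigma> e" if "e \<in> E" for e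
  proof -
    obtain v w where vw: "v \<in> V" "w \<in> V" "v \<noteq> w" "e = {v, w}"
      using edge_cases[OF assms \<open>e \<in> E\<close>] by blast
    then show ?thesis by (simp add: edge_interaction_pair compose_eq)
  qed
  then show ?thesis by (simp add: xy_weight_def)
qed

lemma xy_expectation_real:
  assumes G: "finite_graph V E"
    and f: "f \<in> borel_measurable (spin_measure V)"
    and cnj_f: "\<And>\<sigma>. f (compose V cnj \<sigma>) = cnj (f \<sigma>)"
  shows "xy_expectation V E \<beta> f \<in> \<real>"
proof -
  let ?w = "\<lambda>\<sigma>. xy_weight E \<beta> \<sigma> / xy_partition V E \<beta>" and ?S = "spin_measure V"
  note [measurable] = xy_weight_measurable[OF G] f
  have E: "xy_expectation V E \<beta> f = (\<integral>\<sigma>. ?w \<sigma> *\<^sub>R f \<sigma> \<partial>?S)"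
    unfolding xy_expectation_def xy_measure_def
    using xy_partition_pos[OF G] xy_weight_pos[THEN less_imp_le]
    by (intro integral_density AE_I2 divide_nonneg_pos) auto
  have "finite V" using G by (simp add: finite_graph_def)
  have m: "compose V cnj \<in> ?S \<rightarrow>\<^sub>M ?S"
    unfolding spin_measure_def compose_def
    by (intro measurable_restrict measurable_compose[OF _ cnj_measurable_circle]) simp
  have "(\<integral>\<sigma>. ?w \<sigma> *\<^sub>R f \<sigma> \<partial>?S) = (\<integral>\<sigma>. ?w \<sigma> *\<^sub>R f \<sigma> \<partial>distr ?S ?S (compose V cnj))"
    by (simp add: distr_spin_measure_cnj[OF \<open>finite V\<close>])
  also have "\<dots> = (\<integral>\<sigma>. ?w (compose V cnj \<sigma>) *\<^sub>R f (compose V cnj \<sigma>) \<partial>?S)"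
    by (rule integral_distr[OF m]) simp
  also have "\<dots> = (\<integral>\<sigma>. cnj (?w \<sigma> *\<^sub>R f \<sigma>) \<partial>?S)"
    by (simp add: xy_weight_compose_cnj[OF G] cnj_f)
  also have "\<dots> = cnj (\<integral>\<sigma>. ?w \<sigma> *\<^sub>R f \<sigma> \<partial>?S)"
    by (rule Bochner_Integration.integral_cnj)
  finally show ?thesis
    unfolding E using Reals_cnj_iff by metis
qed

lemma xy_correlations_real:
  assumes G: "finite_graph V E" and V: "a \<in> V" "b \<in> V" "c \<in> V"
  shows "xy_expectation V E \<beta> (\<lambda>\<sigma>. \<sigma> a * cnj (\<sigma> b)) \<in> \<real>"
    and "xy_expectation V E \<beta> (\<lambda>\<sigma>. \<sigma> a * \<sigma> b * cnj (\<sigma> c) ^ 2) \<in> \<real>"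
proof -
  note [measurable] = spin_measurable[OF V(1)] spin_measurable[OF V(2)] spin_measurable[OF V(3)]
  have [measurable]: "cnj \<in> borel_measurable borel"
    by (intro borel_measurable_continuous_onI continuous_intros)
  show "xy_expectation V E \<beta> (\<lambda>\<sigma>. \<sigma> a * cnj (\<sigma> b)) \<in> \<real>"
    by (rule xy_expectation_real[OF G]) (use V in \<open>simp_all add: compose_eq\<close>)
  show "xy_expectation V E \<beta> (\<lambda>\<sigma>. \<sigma> a * \<sigma> b * cnj (\<sigma> c) ^ 2) \<in> \<real>"
    by (rule xy_expectation_real[OF G]) (use V in \<open>simp_all add: compose_eq\<close>)
qed

end

theory Submission
  imports Defs
begin

text \<open>
  Take two independent copies \<open>\<sigma>\<close>, \<open>\<sigma>'\<close> of the model and pass to half angles, \<open>\<sigma> v = z v * cnj (w v)\<close>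
  and \<open>\<sigma>' v = z v * w v\<close>. If \<open>z\<close> and \<open>w\<close> are independent and uniform, then so are \<open>\<sigma>\<close> and \<open>\<sigma>'\<close>, and
  the two interactions of an edge add up to the product of its interactions for \<open>z\<close> and for \<open>w\<close>.
  Both differences in question become positive multiples of the integral of
  \<open>P z * Im (w a * cnj (w c)) * Im (w b * cnj (w c))\<close> against the joint weight, where \<open>P z\<close> is
  \<open>z a * cnj (z b)\<close> for the first inequality and \<open>z a * z b * cnj (z c)\<^sup>2\<close> for the second.
  Expanding the exponential leaves products of an integral over \<open>z\<close> and an integral over \<open>w\<close>.
  The former integrates a polynomial in \<open>z v\<close>, \<open>cnj (z v)\<close> with nonnegative coefficients, so it is
  nonnegative by orthogonality of characters. In the latter, rotation invariance allows to fix
  \<open>w c = 1\<close>; then the integrand is a polynomial in \<open>Re (w v)\<close>, \<open>Im (w v)\<close> with nonnegative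
  coefficients, and every monomial has nonnegative integral by reflection symmetry.
\<close>

section \<open>The uniform measure on the circle\<close>

lemma emeasure_lborel_shift_vimage:
  fixes c :: real
  assumes "X \<in> sets borel"
  shows "emeasure lborel ((+) c -` X) = emeasure lborel X"
proof -
  have "emeasure lborel X = emeasure (distr lborel borel ((+) c)) X"
    by (simp add: lborel_distr_plus)
  also have "\<dots> = emeasure lborel ((+) c -` X)"
    using assms by (subst emeasure_distr) auto
  finally show ?thesis by simp
qed

text \<open>Translating by \<open>s\<close> moves the window to \<open>{s..<s + p}\<close>. Cutting
  it at \<open>p\<close> and moving the overhanging piece back by one period reassembles
  \<open>{0..<p}\<close>.\<close>

lemma emeasure_periodic_shift:
  fixes B :: "real set"
  assumes B: "B \<in> sets borel" and per: "\<And>t. p + t \<in> B \<longleftrightarrow> t \<in> B" and s: "0 \<le> s" "s \<le> p"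
  shows "emeasure lborel ({0..<p} \<inter> (+) s -` B) = emeasure lborel ({0..<p} \<inter> B)"
proof -
  have "emeasure lborel ({0..<p} \<inter> (+) s -` B) = emeasure lborel ((+) s -` ({s..<s + p} \<inter> B))"
    by (rule arg_cong[where f = "emeasure lborel"]) auto
  also have "\<dots> = emeasure lborel ({s..<s + p} \<inter> B)"
    using B by (intro emeasure_lborel_shift_vimage) auto
  also have "{s..<s + p} \<inter> B = ({s..<p} \<inter> B) \<union> ({p..<p + s} \<inter> B)"
    using s by auto
  also have "emeasure lborel \<dots> = emeasure lborel ({s..<p} \<inter> B) + emeasure lborel ({p..<p + s} \<inter> B)"
    using B by (intro plus_emeasure[symmetric]) auto
  also have "emeasure lborel ({p..<p + s} \<inter> B) = emeasure lborel ((+) p -` ({p..<p + s} \<inter> B))"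
    using B by (intro emeasure_lborel_shift_vimage[symmetric]) auto
  also have "(+) p -` ({p..<p + s} \<inter> B) = {0..<s} \<inter> B"
    using per by auto
  also have "emeasure lborel ({s..<p} \<inter> B) + emeasure lborel ({0..<s} \<inter> B)
      = emeasure lborel (({s..<p} \<inter> B) \<union> ({0..<s} \<inter> B))"
    using B by (intro plus_emeasure) auto
  also have "({s..<p} \<inter> B) \<union> ({0..<s} \<inter> B) = {0..<p} \<inter> B"
    using s by auto
  finally show ?thesis .
qed

lemma measurable_unif_circleI:
  assumes "f \<in> borel_measurable M" "\<And>x. x \<in> space M \<Longrightarrow> norm (f x) = 1"
  shows "f \<in> M \<rightarrow>\<^sub>M unif_circle"
proof -
  have "f \<in> M \<rightarrow>\<^sub>M restrict_space borel (sphere 0 1)"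
    using assms by (auto simp: measurable_restrict_space2_iff)
  then show ?thesis
    by (simp add: sets_unif_circle cong: measurable_cong_sets)
qed

lemma borel_measurable_unif_circle:
  assumes "continuous_on UNIV f"
  shows "f \<in> borel_measurable unif_circle"
proof -
  have "f \<in> borel_measurable (restrict_space borel (sphere 0 1))"
    using assms by (intro measurable_restrict_space1 borel_measurable_continuous_onI)
  then show ?thesis
    by (simp add: sets_unif_circle cong: measurable_cong_sets)
qed

lemma borel_measurable_cnj [measurable]: "cnj \<in> borel_measurable borel"
  by (intro borel_measurable_continuous_onI continuous_intros)

lemma measurable_rotate_circle:
  assumes "norm \<zeta> = 1"
  shows "(\<lambda>z. \<zeta> * z) \<in> unif_circle \<rightarrow>\<^sub>M unif_circle"
  by (rule measurable_unif_circleI)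
     (use assms in \<open>auto simp: norm_mult space_unif_circle intro!: borel_measurable_unif_circle continuous_intros\<close>)

lemma measurable_square_circle: "(\<lambda>z. z\<^sup>2) \<in> unif_circle \<rightarrow>\<^sub>M unif_circle"
  by (rule measurable_unif_circleI)
     (auto simp: norm_power space_unif_circle intro!: borel_measurable_unif_circle continuous_intros)

text \<open>The endpoint \<open>2 * pi\<close> is a null set, so the closed interval of the
  definition may be replaced by a half-open one. A half-open period is the form required by
  \<open>emeasure_periodic_shift\<close>.\<close>

lemma emeasure_unif_circle:
  assumes "A \<in> sets unif_circle"
  shows "emeasure unif_circle A = emeasure lborel ({0..<2 * pi} \<inter> cis -` A) / emeasure lborel {0..2 * pi}"
    and "cis -` A \<in> sets borel"
proof -
  have A: "A \<in> sets (restrict_space borel (sphere 0 1))"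
    using assms by (simp add: sets_unif_circle)
  have "cis \<in> borel \<rightarrow>\<^sub>M restrict_space borel (sphere (0::complex) 1)"
    using cis_measurable_circle by simp
  from measurable_sets[OF this A] show B: "cis -` A \<in> sets borel" by simp
  have "emeasure unif_circle A = emeasure lborel ({0..2 * pi} \<inter> cis -` A) / emeasure lborel {0..2 * pi}"
    using A B by (simp add: unif_circle_def emeasure_distr[OF cis_measurable_circle])
  also have "emeasure lborel ({0..2 * pi} \<inter> cis -` A) = emeasure lborel ({0..<2 * pi} \<inter> cis -` A)"
    by (rule emeasure_eq_AE) (use B AE_lborel_singleton[of "2 * pi"] in \<open>auto elim!: eventually_mono\<close>)
  finally show "emeasure unif_circle A
      = emeasure lborel ({0..<2 * pi} \<inter> cis -` A) / emeasure lborel {0..2 * pi}" .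
qed

text \<open>On angles a rotation is a translation, and preimages under \<open>cis\<close> are
  \<open>2 * pi\<close>-periodic, so the periodic shift invariance of Lebesgue measure
  applies.\<close>

lemma distr_unif_circle_rotate:
  assumes "norm \<zeta> = 1"
  shows "distr unif_circle unif_circle (\<lambda>z. \<zeta> * z) = unif_circle"
proof (rule measure_eqI)
  obtain s where s: "0 \<le> s" "s < 2 * pi" "\<zeta> = cis s"
    using assms complex_norm_eq_1_exp_eq[of \<zeta>] Arg2pi[of \<zeta>]
    by (metis cis_conv_exp complex_norm_eq_1_exp)
  fix A assume "A \<in> sets (distr unif_circle unif_circle (\<lambda>z. \<zeta> * z))"
  then have A: "A \<in> sets unif_circle" by simp
  let ?A = "(\<lambda>z. \<zeta> * z) -` A \<inter> space unif_circle"
  have A': "?A \<in> sets unif_circle"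
    by (rule measurable_sets[OF measurable_rotate_circle[OF assms] A])
  have eq: "cis -` ?A = (+) s -` (cis -` A)"
    by (auto simp: s cis_mult space_unif_circle)
  have per: "2 * pi + t \<in> cis -` A \<longleftrightarrow> t \<in> cis -` A" for t
    by (simp flip: cis_mult)
  have "emeasure unif_circle ?A = emeasure unif_circle A"
    using emeasure_periodic_shift[OF emeasure_unif_circle(2)[OF A] per s(1)] s(2)
    unfolding emeasure_unif_circle(1)[OF A] emeasure_unif_circle(1)[OF A'] eq by simp
  then show "emeasure (distr unif_circle unif_circle (\<lambda>z. \<zeta> * z)) A = emeasure unif_circle A"
    by (simp add: emeasure_distr measurable_rotate_circle[OF assms] A)
qed simp

lemma nn_integral_unif_circle_rotate:
  assumes "norm \<zeta> = 1" "f \<in> borel_measurable unif_circle"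
  shows "(\<integral>\<^sup>+z. f (\<zeta> * z) \<partial>unif_circle) = (\<integral>\<^sup>+z. f z \<partial>unif_circle)"
  using nn_integral_distr[OF measurable_rotate_circle[OF assms(1)], of f] assms(2)
  by (simp add: distr_unif_circle_rotate[OF assms(1)])

lemma integral_unif_circle_rotate:
  fixes f :: "complex \<Rightarrow> complex"
  assumes "norm \<zeta> = 1" "f \<in> borel_measurable unif_circle"
  shows "(\<integral>z. f (\<zeta> * z) \<partial>unif_circle) = (\<integral>z. f z \<partial>unif_circle)"
  using integral_distr[OF measurable_rotate_circle[OF assms(1)], of f] assms(2)
  by (simp add: distr_unif_circle_rotate[OF assms(1)])

text \<open>Uniqueness of the Haar measure: the image under squaring is again rotation invariant, and
  integrating \<open>indicator A (z\<^sup>2 * w)\<close> in the two possible orders identifies it.\<close>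

lemma distr_unif_circle_square: "distr unif_circle unif_circle (\<lambda>z. z\<^sup>2) = unif_circle"
proof (rule measure_eqI)
  interpret prob_space unif_circle by (rule prob_space_unif_circle)
  interpret P: pair_sigma_finite unif_circle unif_circle ..
  fix A assume "A \<in> sets (distr unif_circle unif_circle (\<lambda>z. z\<^sup>2))"
  then have A [measurable]: "A \<in> sets unif_circle" by simp
  let ?f = "indicator A :: complex \<Rightarrow> ennreal"
  have f [measurable]: "?f \<in> borel_measurable unif_circle" by simp
  note [measurable] = measurable_square_circle
  have [measurable]: "(\<lambda>p. (fst p)\<^sup>2 * snd p) \<in> unif_circle \<Otimes>\<^sub>M unif_circle \<rightarrow>\<^sub>M unif_circle"
    by (rule measurable_unif_circleI)
       (auto simp: space_pair_measure space_unif_circle norm_mult norm_power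
          intro!: borel_measurable_times borel_measurable_power
            measurable_compose[OF measurable_fst] measurable_compose[OF measurable_snd]
            borel_measurable_unif_circle continuous_intros)
  have sq: "(\<integral>\<^sup>+z. ?f (z\<^sup>2 * w) \<partial>unif_circle) = (\<integral>\<^sup>+z. ?f (z\<^sup>2) \<partial>unif_circle)"
    if w: "w \<in> space unif_circle" for w
  proof -
    \<comment> \<open>A square root of \<open>w\<close> absorbs the factor \<open>w\<close> into the
      square, as a rotation of \<open>z\<close>.\<close>
    have n: "norm (csqrt w) = 1"
      using w by (simp add: space_unif_circle norm_csqrt)
    have "(\<integral>\<^sup>+z. ?f (z\<^sup>2 * w) \<partial>unif_circle) = (\<integral>\<^sup>+z. ?f ((csqrt w * z)\<^sup>2) \<partial>unif_circle)"
      by (simp add: power_mult_distrib mult.commute)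
    also have "\<dots> = (\<integral>\<^sup>+z. ?f (z\<^sup>2) \<partial>unif_circle)"
      by (rule nn_integral_unif_circle_rotate[OF n]) measurable
    finally show ?thesis .
  qed
  have "emeasure (distr unif_circle unif_circle (\<lambda>z. z\<^sup>2)) A = (\<integral>\<^sup>+z. ?f (z\<^sup>2) \<partial>unif_circle)"
    using nn_integral_distr[OF measurable_square_circle, of ?f] by simp
  also have "\<dots> = (\<integral>\<^sup>+w. (\<integral>\<^sup>+z. ?f (z\<^sup>2 * w) \<partial>unif_circle) \<partial>unif_circle)"
    by (simp add: sq emeasure_space_1 cong: nn_integral_cong)
  also have "\<dots> = (\<integral>\<^sup>+z. (\<integral>\<^sup>+w. ?f (z\<^sup>2 * w) \<partial>unif_circle) \<partial>unif_circle)"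
    by (rule P.Fubini') measurable
  also have "\<dots> = (\<integral>\<^sup>+z. (\<integral>\<^sup>+w. ?f w \<partial>unif_circle) \<partial>unif_circle)"
    by (intro nn_integral_cong nn_integral_unif_circle_rotate)
       (auto simp: space_unif_circle norm_power)
  also have "\<dots> = emeasure unif_circle A"
    by (simp add: emeasure_space_1)
  finally show "emeasure (distr unif_circle unif_circle (\<lambda>z. z\<^sup>2)) A = emeasure unif_circle A" .
qed simp

section \<open>Moments of the uniform measure on the circle\<close>

text \<open>Orthogonality of characters: for \<open>p = q\<close> the integrand is 1 on the circle,
  and otherwise a suitable rotation changes the sign of the integral, which therefore
  vanishes.\<close>

lemma integral_circle_character:
  "(\<integral>z. z ^ p * cnj z ^ q \<partial>unif_circle) \<in> \<real>\<^sub>\<ge>\<^sub>0"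
proof (cases "p = q")
  case True
  interpret prob_space unif_circle by (rule prob_space_unif_circle)
  have "(\<integral>z. z ^ p * cnj z ^ q \<partial>unif_circle) = (\<integral>z. 1 \<partial>unif_circle)"
    by (rule Bochner_Integration.integral_cong[OF refl])
       (simp add: True space_unif_circle complex_norm_square[symmetric] flip: power_mult_distrib)
  then show ?thesis by (simp add: prob_space)
next
  case False
  \<comment> \<open>The angle is chosen so that the rotation multiplies the integrand by
    \<open>cis pi = -1\<close>. Taking the difference \<open>p - q\<close> in the reals covers both
    signs.\<close>
  let ?I = "\<integral>z. z ^ p * cnj z ^ q \<partial>unif_circle" and ?\<zeta> = "cis (pi / (real p - real q))"
  have "?\<zeta> ^ p * cnj ?\<zeta> ^ q = cis (real p * (pi / (real p - real q)) - real q * (pi / (real p - real q)))"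
    unfolding cis_cnj Complex.DeMoivre cis_mult by simp
  also have "real p * (pi / (real p - real q)) - real q * (pi / (real p - real q)) = pi"
    using False unfolding left_diff_distrib[symmetric] by simp
  finally have z: "?\<zeta> ^ p * cnj ?\<zeta> ^ q = -1" by simp
  have "?I = (\<integral>z. (?\<zeta> * z) ^ p * cnj (?\<zeta> * z) ^ q \<partial>unif_circle)"
    by (rule integral_unif_circle_rotate[symmetric])
       (auto intro!: borel_measurable_unif_circle continuous_intros)
  also have "\<dots> = (\<integral>z. (?\<zeta> ^ p * cnj ?\<zeta> ^ q) * (z ^ p * cnj z ^ q) \<partial>unif_circle)"
    by (rule Bochner_Integration.integral_cong) (simp_all add: power_mult_distrib mult_ac)
  also have "\<dots> = - ?I" unfolding z by simp
  finally show ?thesis by simp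
qed

text \<open>If \<open>q\<close> is odd, conjugation reverses the sign of the integrand. If only
  \<open>p\<close> is odd, the map from \<open>z\<close> to \<open>- z\<close> does. If both are
  even, the integrand is nonnegative pointwise.\<close>

lemma integral_circle_Re_Im:
  "(\<integral>z. of_real (Re z) ^ p * of_real (Im z) ^ q \<partial>unif_circle) \<in> (\<real>\<^sub>\<ge>\<^sub>0 :: complex set)"
proof -
  let ?f = "\<lambda>z. complex_of_real (Re z) ^ p * of_real (Im z) ^ q"
  let ?I = "\<integral>z. ?f z \<partial>unif_circle"
  have m: "?f \<in> borel_measurable unif_circle"
    by (intro borel_measurable_unif_circle continuous_intros)
  consider "odd q" | "odd p" "even q" | "even p" "even q" by blast
  then show ?thesis
  proof cases
    case 1
    have "?I = (\<integral>z. ?f z \<partial>distr unif_circle unif_circle cnj)"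
      by (simp add: distr_unif_circle_cnj)
    also have "\<dots> = (\<integral>z. ?f (cnj z) \<partial>unif_circle)"
      by (rule integral_distr[OF cnj_measurable_circle m])
    also have "\<dots> = - ?I" using 1 by simp
    finally show ?thesis by simp
  next
    case 2
    have "?I = (\<integral>z. ?f (-1 * z) \<partial>unif_circle)"
      by (rule integral_unif_circle_rotate[symmetric, OF _ m]) simp
    also have "\<dots> = - ?I" using 2 by simp
    finally show ?thesis by simp
  next
    case 3
    have "?I = of_real (\<integral>z. Re z ^ p * Im z ^ q \<partial>unif_circle)"
      by (simp flip: of_real_power of_real_mult)
    moreover have "0 \<le> (\<integral>z. Re z ^ p * Im z ^ q \<partial>unif_circle)"
      using 3 by (intro integral_nonneg_AE AE_I2 mult_nonneg_nonneg) (auto simp: zero_le_even_power)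
    ultimately show ?thesis by simp
  qed
qed

section \<open>Measure-preserving maps of spin configurations\<close>

text \<open>A finite product measure is determined by its values on boxes, and the preimage of a box
  under a sitewise map is the box of the preimages.\<close>

lemma distr_spin_measure_componentwise:
  assumes V: "finite V"
    and g: "\<And>v. v \<in> V \<Longrightarrow> g v \<in> unif_circle \<rightarrow>\<^sub>M unif_circle"
    and inv: "\<And>v. v \<in> V \<Longrightarrow> distr unif_circle unif_circle (g v) = unif_circle"
  shows "distr (spin_measure V) (spin_measure V) (\<lambda>\<sigma>. \<lambda>v\<in>V. g v (\<sigma> v)) = spin_measure V"
proof -
  interpret prob_space unif_circle by (rule prob_space_unif_circle)
  interpret product_prob_space "\<lambda>_. unif_circle" V ..
  interpret finite_product_prob_space "\<lambda>_. unif_circle" V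
    by standard (rule V)
  have m: "(\<lambda>\<sigma>. \<lambda>v\<in>V. g v (\<sigma> v)) \<in> spin_measure V \<rightarrow>\<^sub>M spin_measure V"
    unfolding spin_measure_def using g by (intro measurable_restrict) (auto intro: measurable_compose)
  show ?thesis
    unfolding spin_measure_def
  proof (rule PiM_eqI[OF V])
    fix A :: "'a \<Rightarrow> complex set"
    assume A: "\<And>v. v \<in> V \<Longrightarrow> A v \<in> sets unif_circle"
    let ?B = "\<lambda>v. g v -` A v \<inter> space unif_circle"
    have B: "?B v \<in> sets unif_circle" if "v \<in> V" for v
      using measurable_sets[OF g A] that by auto
    have "emeasure (distr (Pi\<^sub>M V (\<lambda>_. unif_circle)) (Pi\<^sub>M V (\<lambda>_. unif_circle)) (\<lambda>\<sigma>. \<lambda>v\<in>V. g v (\<sigma> v))) (Pi\<^sub>E V A)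
        = emeasure (Pi\<^sub>M V (\<lambda>_. unif_circle))
            ((\<lambda>\<sigma>. \<lambda>v\<in>V. g v (\<sigma> v)) -` Pi\<^sub>E V A \<inter> space (Pi\<^sub>M V (\<lambda>_. unif_circle)))"
      using m A V by (subst emeasure_distr) (auto simp: spin_measure_def intro!: sets_PiM_I_finite)
    also have "(\<lambda>\<sigma>. \<lambda>v\<in>V. g v (\<sigma> v)) -` Pi\<^sub>E V A \<inter> space (Pi\<^sub>M V (\<lambda>_. unif_circle)) = Pi\<^sub>E V ?B"
      by (auto simp: space_PiM PiE_iff)
    also have "emeasure (Pi\<^sub>M V (\<lambda>_. unif_circle)) (Pi\<^sub>E V ?B) = (\<Prod>v\<in>V. emeasure unif_circle (?B v))"
      using V B by (intro emeasure_PiM) auto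
    also have "\<dots> = (\<Prod>v\<in>V. emeasure unif_circle (A v))"
    proof (rule prod.cong[OF refl])
      fix v assume v: "v \<in> V"
      show "emeasure unif_circle (?B v) = emeasure unif_circle (A v)"
        using emeasure_distr[OF g[OF v] A[OF v]] inv[OF v] by simp
    qed
    finally show "emeasure (distr (Pi\<^sub>M V (\<lambda>_. unif_circle)) (Pi\<^sub>M V (\<lambda>_. unif_circle))
        (\<lambda>\<sigma>. \<lambda>v\<in>V. g v (\<sigma> v))) (Pi\<^sub>E V A) = (\<Prod>v\<in>V. emeasure unif_circle (A v))" .
  qed simp
qed

lemma distr_spin_measure_rotate:
  assumes "finite V" "\<And>v. v \<in> V \<Longrightarrow> norm (\<zeta> v) = 1"
  shows "distr (spin_measure V) (spin_measure V) (\<lambda>\<sigma>. \<lambda>v\<in>V. \<zeta> v * \<sigma> v) = spin_measure V"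
  using assms
  by (intro distr_spin_measure_componentwise measurable_rotate_circle distr_unif_circle_rotate) auto

lemma distr_spin_measure_rotate_square:
  assumes V: "finite V" and \<zeta>: "\<And>v. v \<in> V \<Longrightarrow> norm (\<zeta> v) = 1"
  shows "distr (spin_measure V) (spin_measure V) (\<lambda>\<sigma>. \<lambda>v\<in>V. \<zeta> v * (\<sigma> v)\<^sup>2) = spin_measure V"
proof (rule distr_spin_measure_componentwise[OF V])
  fix v assume v: "v \<in> V"
  show "(\<lambda>z. \<zeta> v * z\<^sup>2) \<in> unif_circle \<rightarrow>\<^sub>M unif_circle"
    by (rule measurable_compose[OF measurable_square_circle measurable_rotate_circle[OF \<zeta>[OF v]]])
  have "distr unif_circle unif_circle (\<lambda>z. \<zeta> v * z\<^sup>2)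
      = distr (distr unif_circle unif_circle (\<lambda>z. z\<^sup>2)) unif_circle (\<lambda>z. \<zeta> v * z)"
    by (subst distr_distr[OF measurable_rotate_circle[OF \<zeta>[OF v]] measurable_square_circle])
       (simp add: comp_def)
  then show "distr unif_circle unif_circle (\<lambda>z. \<zeta> v * z\<^sup>2) = unif_circle"
    by (simp add: distr_unif_circle_square distr_unif_circle_rotate[OF \<zeta>[OF v]])
qed

text \<open>By Fubini it suffices to compare sections: over \<open>x\<close>, the section of the
  preimage of \<open>A\<close> is the preimage of the section of \<open>A\<close> under
  \<open>g x\<close>, which preserves \<open>N\<close>.\<close>

lemma distr_pair_skew:
  assumes "sigma_finite_measure N"
    and g: "(\<lambda>(x, y). g x y) \<in> M \<Otimes>\<^sub>M N \<rightarrow>\<^sub>M N"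
    and inv: "\<And>x. x \<in> space M \<Longrightarrow> distr N N (g x) = N"
  shows "distr (M \<Otimes>\<^sub>M N) (M \<Otimes>\<^sub>M N) (\<lambda>(x, y). (x, g x y)) = M \<Otimes>\<^sub>M N"
proof (rule measure_eqI)
  interpret N: sigma_finite_measure N by fact
  note [measurable] = g
  have m: "(\<lambda>(x, y). (x, g x y)) \<in> M \<Otimes>\<^sub>M N \<rightarrow>\<^sub>M M \<Otimes>\<^sub>M N" by measurable
  fix A assume "A \<in> sets (distr (M \<Otimes>\<^sub>M N) (M \<Otimes>\<^sub>M N) (\<lambda>(x, y). (x, g x y)))"
  then have A: "A \<in> sets (M \<Otimes>\<^sub>M N)" by simp
  let ?A = "(\<lambda>(x, y). (x, g x y)) -` A \<inter> space (M \<Otimes>\<^sub>M N)"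
  have "emeasure (M \<Otimes>\<^sub>M N) ?A = (\<integral>\<^sup>+x. emeasure N (Pair x -` ?A) \<partial>M)"
    using measurable_sets[OF m A] by (rule N.emeasure_pair_measure_alt)
  also have "\<dots> = (\<integral>\<^sup>+x. emeasure N (Pair x -` A) \<partial>M)"
  proof (rule nn_integral_cong)
    fix x assume x: "x \<in> space M"
    have gx: "g x \<in> N \<rightarrow>\<^sub>M N"
      using measurable_compose[OF measurable_Pair1'[OF x] g] by simp
    have "Pair x -` ?A = g x -` (Pair x -` A) \<inter> space N"
      using x by (auto simp: space_pair_measure)
    then show "emeasure N (Pair x -` ?A) = emeasure N (Pair x -` A)"
      using emeasure_distr[OF gx sets_Pair1[OF A], of x] inv[OF x] by simp
  qed
  also have "\<dots> = emeasure (M \<Otimes>\<^sub>M N) A"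
    using A by (rule N.emeasure_pair_measure_alt[symmetric])
  finally show "emeasure (distr (M \<Otimes>\<^sub>M N) (M \<Otimes>\<^sub>M N) (\<lambda>(x, y). (x, g x y))) A = emeasure (M \<Otimes>\<^sub>M N) A"
    using emeasure_distr[OF m A] by simp
qed simp

lemma measurable_spin_measureI:
  assumes "\<And>v. v \<in> V \<Longrightarrow> (\<lambda>x. f x v) \<in> borel_measurable N"
    and "\<And>v x. v \<in> V \<Longrightarrow> x \<in> space N \<Longrightarrow> norm (f x v) = 1"
  shows "(\<lambda>x. \<lambda>v\<in>V. f x v) \<in> N \<rightarrow>\<^sub>M spin_measure V"
  unfolding spin_measure_def using assms by (intro measurable_restrict measurable_unif_circleI) auto

section \<open>Two independent copies and the half-angle map\<close>

abbreviation spin_measure2 :: "'v set \<Rightarrow> (('v \<Rightarrow> complex) \<times> ('v \<Rightarrow> complex)) measure" where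
  "spin_measure2 V \<equiv> spin_measure V \<Otimes>\<^sub>M spin_measure V"

lemma spin2_measurable:
  assumes "v \<in> V"
  shows "(\<lambda>p. fst p v) \<in> borel_measurable (spin_measure2 V)"
    and "(\<lambda>p. snd p v) \<in> borel_measurable (spin_measure2 V)"
  by (rule measurable_compose[OF measurable_fst spin_measurable[OF assms]]
           measurable_compose[OF measurable_snd spin_measurable[OF assms]])+

text \<open>On angles the outputs are the difference and the sum of those of \<open>z\<close> and
  \<open>w\<close>. The pair is ordered \<open>(w, z)\<close>, so below \<open>fst p\<close> is
  always \<open>w\<close> and \<open>snd p\<close> is always \<open>z\<close>.\<close>

definition half_angle :: "'v set \<Rightarrow> ('v \<Rightarrow> complex) \<times> ('v \<Rightarrow> complex) \<Rightarrow> ('v \<Rightarrow> complex) \<times> ('v \<Rightarrow> complex)" where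
  "half_angle V = (\<lambda>(w, z). (\<lambda>v\<in>V. z v * cnj (w v), \<lambda>v\<in>V. z v * w v))"

lemma measurable_half_angle: "half_angle V \<in> spin_measure2 V \<rightarrow>\<^sub>M spin_measure2 V"
  unfolding half_angle_def case_prod_beta
  by (intro measurable_Pair measurable_spin_measureI borel_measurable_times spin2_measurable
        measurable_compose[OF spin2_measurable(1) borel_measurable_cnj])
     (auto simp: space_pair_measure norm_mult norm_spin)

text \<open>The half-angle map is the composition of the skew products \<open>(w, z) \<mapsto> (w, z * cnj w)\<close> and
  \<open>(y, w) \<mapsto> (y, y * w\<^sup>2)\<close>, with a swap in between. It is two-to-one, which is harmless.\<close>

lemma distr_half_angle:
  assumes V: "finite V"
  shows "distr (spin_measure2 V) (spin_measure2 V) (half_angle V) = spin_measure2 V"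
proof -
  let ?M = "spin_measure V" and ?P = "spin_measure2 V"
  interpret prob_space ?M by (rule prob_space_spin_measure)
  interpret P: pair_sigma_finite ?M ?M ..
  let ?g1 = "\<lambda>w z. \<lambda>v\<in>V. cnj (w v) * z v" and ?g2 = "\<lambda>y w. \<lambda>v\<in>V. y v * (w v)\<^sup>2"
  let ?S1 = "\<lambda>(w, z). (w, ?g1 w z)" and ?S2 = "\<lambda>(y, w). (y, ?g2 y w)"
  have g1: "(\<lambda>(w, z). ?g1 w z) \<in> ?P \<rightarrow>\<^sub>M ?M"
    unfolding case_prod_beta
    by (intro measurable_spin_measureI borel_measurable_times spin2_measurable
          measurable_compose[OF spin2_measurable(1) borel_measurable_cnj])
       (auto simp: space_pair_measure norm_mult norm_spin)
  have g2: "(\<lambda>(y, w). ?g2 y w) \<in> ?P \<rightarrow>\<^sub>M ?M"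
    unfolding case_prod_beta
    by (intro measurable_spin_measureI borel_measurable_times borel_measurable_power spin2_measurable)
       (auto simp: space_pair_measure norm_mult norm_power norm_spin)
  have S1: "distr ?P ?P ?S1 = ?P"
    by (rule distr_pair_skew[OF _ g1])
       (use V in \<open>auto intro!: distr_spin_measure_rotate simp: norm_spin sigma_finite_measure_axioms\<close>)
  have S2: "distr ?P ?P ?S2 = ?P"
    by (rule distr_pair_skew[OF _ g2])
       (use V in \<open>auto intro!: distr_spin_measure_rotate_square simp: norm_spin sigma_finite_measure_axioms\<close>)
  have sw: "distr ?P ?P (\<lambda>(x, y). (y, x)) = ?P"
    by (rule P.distr_pair_swap[symmetric])
  have m1: "?S1 \<in> ?P \<rightarrow>\<^sub>M ?P" using g1 by measurable
  have m2: "?S2 \<in> ?P \<rightarrow>\<^sub>M ?P" using g2 by measurable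
  have msw: "(\<lambda>(x, y). (y, x)) \<in> ?P \<rightarrow>\<^sub>M ?P" by measurable
  have "?P = distr (distr (distr ?P ?P ?S1) ?P (\<lambda>(x, y). (y, x))) ?P ?S2"
    by (simp only: S1 S2 sw)
  also have "\<dots> = distr ?P ?P (?S2 \<circ> ((\<lambda>(x, y). (y, x)) \<circ> ?S1))"
    by (simp only: distr_distr[OF msw m1] distr_distr[OF m2 measurable_comp[OF m1 msw]])
  also have "\<dots> = distr ?P ?P (half_angle V)"
  proof (rule distr_cong[OF refl refl])
    fix p assume p: "p \<in> space ?P"
    \<comment> \<open>The composed skew products give \<open>z * cnj w\<close> times the square of
      \<open>w\<close> in the second coordinate, which is \<open>z * w\<close> because
      \<open>w\<close> is unimodular.\<close>
    have "cnj (fst p v) * snd p v * (fst p v)\<^sup>2 = snd p v * fst p v" if "v \<in> V" for v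
    proof -
      have "fst p v * cnj (fst p v) = 1"
        using p that by (auto simp: space_pair_measure norm_spin complex_norm_square[symmetric])
      then show ?thesis
        by (metis (no_types, lifting) mult.assoc mult.commute mult.right_neutral power2_eq_square)
    qed
    then show "(?S2 \<circ> ((\<lambda>(x, y). (y, x)) \<circ> ?S1)) p = half_angle V p"
      by (auto simp: half_angle_def case_prod_beta fun_eq_iff mult.commute)
  qed
  finally show ?thesis by simp
qed

section \<open>Bounded measurable functions\<close>

text \<open>Unlike integrability, this property is closed under products, and on a finite measure
  space it implies integrability. Integrability conditions thus reduce to the closure rules in
  \<open>bm_intros\<close>. The bound is asked for on \<open>space M\<close> only, since spins are
  unimodular only there.\<close>

definition bounded_measurable :: "'a measure \<Rightarrow> ('a \<Rightarrow> complex) \<Rightarrow> bool" where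
  "bounded_measurable M f \<longleftrightarrow> f \<in> borel_measurable M \<and> (\<exists>B. \<forall>x\<in>space M. norm (f x) \<le> B)"

named_theorems bm_intros

lemma bounded_measurableI:
  assumes "f \<in> borel_measurable M" "\<And>x. x \<in> space M \<Longrightarrow> norm (f x) \<le> B"
  shows "bounded_measurable M f"
  using assms by (auto simp: bounded_measurable_def)

lemma bounded_measurableD: "bounded_measurable M f \<Longrightarrow> f \<in> borel_measurable M"
  by (simp add: bounded_measurable_def)

lemma bounded_measurable_const [bm_intros]: "bounded_measurable M (\<lambda>_. c)"
  by (auto simp: bounded_measurable_def)

lemma bounded_measurable_add [bm_intros]:
  assumes "bounded_measurable M f" "bounded_measurable M g"
  shows "bounded_measurable M (\<lambda>x. f x + g x)"
proof -
  from assms obtain A B where "\<forall>x\<in>space M. norm (f x) \<le> A" "\<forall>x\<in>space M. norm (g x) \<le> B"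
    by (auto simp: bounded_measurable_def)
  then have "norm (f x + g x) \<le> A + B" if "x \<in> space M" for x
    using that by (intro order.trans[OF norm_triangle_ineq] add_mono) auto
  with assms show ?thesis
    by (intro bounded_measurableI) (auto dest!: bounded_measurableD)
qed

lemma bounded_measurable_mult [bm_intros]:
  assumes "bounded_measurable M f" "bounded_measurable M g"
  shows "bounded_measurable M (\<lambda>x. f x * g x)"
proof -
  from assms obtain A B where "\<forall>x\<in>space M. norm (f x) \<le> A" "\<forall>x\<in>space M. norm (g x) \<le> B"
    by (auto simp: bounded_measurable_def)
  then have "norm (f x * g x) \<le> \<bar>A\<bar> * \<bar>B\<bar>" if "x \<in> space M" for x
    unfolding norm_mult using that by (intro mult_mono) force+
  with assms show ?thesis
    by (intro bounded_measurableI) (auto dest!: bounded_measurableD)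
qed

lemma bounded_measurable_cnj [bm_intros]:
  assumes "bounded_measurable M f"
  shows "bounded_measurable M (\<lambda>x. cnj (f x))"
  using assms by (auto simp: bounded_measurable_def intro: measurable_compose[OF _ borel_measurable_cnj])

lemma bounded_measurable_diff [bm_intros]:
  assumes "bounded_measurable M f" "bounded_measurable M g"
  shows "bounded_measurable M (\<lambda>x. f x - g x)"
  using bounded_measurable_add[OF assms(1) bounded_measurable_mult[OF bounded_measurable_const[of _ "-1"] assms(2)]]
  by simp

lemma bounded_measurable_power [bm_intros]:
  assumes "bounded_measurable M f"
  shows "bounded_measurable M (\<lambda>x. f x ^ n)"
  by (induction n) (simp_all add: bm_intros assms)

lemma bounded_measurable_sum [bm_intros]:
  assumes "\<And>i. i \<in> I \<Longrightarrow> bounded_measurable M (f i)"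
  shows "bounded_measurable M (\<lambda>x. \<Sum>i\<in>I. f i x)"
  using assms by (induction I rule: infinite_finite_induct) (simp_all add: bm_intros)

lemma bounded_measurable_prod [bm_intros]:
  assumes "\<And>i. i \<in> I \<Longrightarrow> bounded_measurable M (f i)"
  shows "bounded_measurable M (\<lambda>x. \<Prod>i\<in>I. f i x)"
  using assms by (induction I rule: infinite_finite_induct) (simp_all add: bm_intros)

lemma bounded_measurable_exp [bm_intros]:
  assumes "bounded_measurable M f"
  shows "bounded_measurable M (\<lambda>x. exp (f x))"
proof -
  from assms obtain B where B: "\<forall>x\<in>space M. norm (f x) \<le> B"
    by (auto simp: bounded_measurable_def)
  have "norm (exp (f x)) \<le> exp B" if "x \<in> space M" for x
    using B that by (intro order.trans[OF norm_exp]) simp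
  then show ?thesis
    using assms by (intro bounded_measurableI) (auto dest!: bounded_measurableD)
qed

lemma bounded_measurable_compose:
  assumes "bounded_measurable N f" "g \<in> M \<rightarrow>\<^sub>M N"
  shows "bounded_measurable M (\<lambda>x. f (g x))"
proof -
  from assms(1) obtain B where "\<forall>y\<in>space N. norm (f y) \<le> B"
    by (auto simp: bounded_measurable_def)
  then show ?thesis
    using measurable_space[OF assms(2)] assms
    by (intro bounded_measurableI[where B = B] measurable_compose[OF assms(2)])
       (auto dest: bounded_measurableD)
qed

lemma bounded_measurable_fst [bm_intros]:
  "bounded_measurable M f \<Longrightarrow> bounded_measurable (M \<Otimes>\<^sub>M N) (\<lambda>p. f (fst p))"
  by (rule bounded_measurable_compose[OF _ measurable_fst])

lemma bounded_measurable_snd [bm_intros]: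
  "bounded_measurable N f \<Longrightarrow> bounded_measurable (M \<Otimes>\<^sub>M N) (\<lambda>p. f (snd p))"
  by (rule bounded_measurable_compose[OF _ measurable_snd])

lemma bounded_measurable_spin [bm_intros]:
  "v \<in> V \<Longrightarrow> bounded_measurable (spin_measure V) (\<lambda>\<sigma>. \<sigma> v)"
  by (rule bounded_measurableI[where B = 1]) (auto simp: spin_measurable norm_spin)

section \<open>Integration over one and two copies\<close>

lemma (in finite_measure) bounded_measurable_integrable:
  assumes "bounded_measurable M f"
  shows "integrable M f"
  using assms by (auto simp: bounded_measurable_def intro: integrable_const_bound)

lemma integrable_spin_measure:
  "bounded_measurable (spin_measure V) f \<Longrightarrow> integrable (spin_measure V) f"
  by (rule finite_measure.bounded_measurable_integrable)
     (rule prob_space.finite_measure[OF prob_space_spin_measure])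

lemma prob_space_spin_measure2: "prob_space (spin_measure2 V)"
  by (rule prob_space_pair) (rule prob_space_spin_measure)+

lemma integrable_spin_measure2:
  "bounded_measurable (spin_measure2 V) f \<Longrightarrow> integrable (spin_measure2 V) f"
  by (rule finite_measure.bounded_measurable_integrable)
     (rule prob_space.finite_measure[OF prob_space_spin_measure2])

lemma integral_spin_measure2_times:
  assumes f: "bounded_measurable (spin_measure V) f" and g: "bounded_measurable (spin_measure V) g"
  shows "(\<integral>p. f (fst p) * g (snd p) \<partial>spin_measure2 V)
    = (\<integral>\<sigma>. f \<sigma> \<partial>spin_measure V) * (\<integral>\<sigma>. g \<sigma> \<partial>spin_measure V)"
proof -
  interpret prob_space "spin_measure V" by (rule prob_space_spin_measure)
  interpret P: pair_sigma_finite "spin_measure V" "spin_measure V" ..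
  have "integrable (spin_measure2 V) (\<lambda>p. f (fst p) * g (snd p))"
    by (intro integrable_spin_measure2 bm_intros f g)
  from P.integral_fst'[OF this] show ?thesis
    by (simp add: integrable_spin_measure f g)
qed

lemma integral_spin_measure2_half_angle:
  assumes V: "finite V" and f: "bounded_measurable (spin_measure2 V) f"
  shows "(\<integral>p. f p \<partial>spin_measure2 V) = (\<integral>p. f (half_angle V p) \<partial>spin_measure2 V)"
  using integral_distr[OF measurable_half_angle bounded_measurableD[OF f]]
  by (simp add: distr_half_angle[OF V])

section \<open>Polynomials with nonnegative coefficients\<close>

text \<open>Sums of monomials in the one-site functions \<open>f v\<close> and \<open>g v\<close>.
  The two families are left abstract because they are used both as \<open>z\<close>,
  \<open>cnj z\<close> and as real and imaginary part. Coefficients arise only from repeated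
  addition; real scalars are kept outside.\<close>

inductive_set polynomial_cone ::
    "('v \<Rightarrow> complex \<Rightarrow> complex) \<Rightarrow> ('v \<Rightarrow> complex \<Rightarrow> complex) \<Rightarrow> 'v set \<Rightarrow> (('v \<Rightarrow> complex) \<Rightarrow> complex) set"
  for f g :: "'v \<Rightarrow> complex \<Rightarrow> complex" and V :: "'v set" where
  one: "(\<lambda>_. 1) \<in> polynomial_cone f g V"
| fst: "h \<in> polynomial_cone f g V \<Longrightarrow> v \<in> V \<Longrightarrow> (\<lambda>\<sigma>. f v (\<sigma> v) * h \<sigma>) \<in> polynomial_cone f g V"
| snd: "h \<in> polynomial_cone f g V \<Longrightarrow> v \<in> V \<Longrightarrow> (\<lambda>\<sigma>. g v (\<sigma> v) * h \<sigma>) \<in> polynomial_cone f g V"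
| add: "h \<in> polynomial_cone f g V \<Longrightarrow> k \<in> polynomial_cone f g V \<Longrightarrow>
    (\<lambda>\<sigma>. h \<sigma> + k \<sigma>) \<in> polynomial_cone f g V"

lemma bounded_measurable_polynomial_cone:
  assumes "h \<in> polynomial_cone f g V"
    and fg: "\<And>v. v \<in> V \<Longrightarrow> bounded_measurable unif_circle (f v)"
      "\<And>v. v \<in> V \<Longrightarrow> bounded_measurable unif_circle (g v)"
  shows "bounded_measurable (spin_measure V) h"
proof -
  have "(\<lambda>\<sigma>. \<sigma> v) \<in> spin_measure V \<rightarrow>\<^sub>M unif_circle" if "v \<in> V" for v
    unfolding spin_measure_def using that by simp
  note [bm_intros] = bounded_measurable_compose[OF fg(1) this] bounded_measurable_compose[OF fg(2) this]
  show ?thesis using assms(1) by induction (auto intro!: bm_intros)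
qed

text \<open>The integral of a monomial factors over the sites into one-site moments, which are
  nonnegative by \<open>mono\<close>; sums preserve nonnegativity.\<close>

lemma integral_polynomial_cone_nonneg:
  assumes V: "finite V"
    and h: "h \<in> polynomial_cone f g V"
    and fg: "\<And>v. v \<in> V \<Longrightarrow> bounded_measurable unif_circle (f v)"
      "\<And>v. v \<in> V \<Longrightarrow> bounded_measurable unif_circle (g v)"
    and mono: "\<And>v p q. v \<in> V \<Longrightarrow> (\<integral>z. f v z ^ p * g v z ^ q \<partial>unif_circle) \<in> \<real>\<^sub>\<ge>\<^sub>0"
  shows "(\<integral>\<sigma>. h \<sigma> \<partial>spin_measure V) \<in> \<real>\<^sub>\<ge>\<^sub>0"
proof -
  let ?m = "\<lambda>p q \<sigma>. \<Prod>v\<in>V. f v (\<sigma> v) ^ p v * g v (\<sigma> v) ^ q v"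
  interpret prob_space unif_circle by (rule prob_space_unif_circle)
  interpret product_sigma_finite "\<lambda>_. unif_circle"
    by standard
  have comp: "(\<lambda>\<sigma>. \<sigma> v) \<in> spin_measure V \<rightarrow>\<^sub>M unif_circle" if "v \<in> V" for v
    unfolding spin_measure_def using that by simp
  have bm: "bounded_measurable (spin_measure V) (?m p q)" for p q
    by (intro bm_intros bounded_measurable_compose[OF fg(1) comp] bounded_measurable_compose[OF fg(2) comp])
  \<comment> \<open>The claim is strengthened by an arbitrary monomial factor, so that in the
    induction a new generator is absorbed by raising one of its exponents.\<close>
  have "(\<integral>\<sigma>. ?m p q \<sigma> * h \<sigma> \<partial>spin_measure V) \<in> \<real>\<^sub>\<ge>\<^sub>0" for p q :: "'a \<Rightarrow> nat"
    using h
  proof (induction arbitrary: p q)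
    case one
    have "(\<integral>\<sigma>. ?m p q \<sigma> \<partial>spin_measure V) = (\<Prod>v\<in>V. \<integral>z. f v z ^ p v * g v z ^ q v \<partial>unif_circle)"
      unfolding spin_measure_def using V
      by (intro product_integral_prod) (auto intro!: bounded_measurable_integrable bm_intros fg)
    also have "\<dots> \<in> \<real>\<^sub>\<ge>\<^sub>0"
      using mono by (induction V rule: infinite_finite_induct) auto
    finally show ?case by simp
  next
    case (fst h v)
    have eq: "?m p q \<sigma> * (f v (\<sigma> v) * h \<sigma>) = ?m (p(v := Suc (p v))) q \<sigma> * h \<sigma>" for \<sigma>
      by (simp add: prod.remove[OF V \<open>v \<in> V\<close>] mult_ac cong: prod.cong_simp)
    show ?case unfolding eq by (rule fst.IH)
  next
    case (snd h v)
    have eq: "?m p q \<sigma> * (g v (\<sigma> v) * h \<sigma>) = ?m p (q(v := Suc (q v))) \<sigma> * h \<sigma>" for \<sigma>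
      by (simp add: prod.remove[OF V \<open>v \<in> V\<close>] mult_ac cong: prod.cong_simp)
    show ?case unfolding eq by (rule snd.IH)
  next
    case (add h k)
    have "integrable (spin_measure V) (\<lambda>\<sigma>. ?m p q \<sigma> * h \<sigma>)"
      "integrable (spin_measure V) (\<lambda>\<sigma>. ?m p q \<sigma> * k \<sigma>)"
      using add.hyps fg
      by (auto intro!: integrable_spin_measure bounded_measurable_mult bm bounded_measurable_polynomial_cone)
    then show ?case
      using add.IH[of p q] by (simp add: distrib_left)
  qed
  from this[of "\<lambda>_. 0" "\<lambda>_. 0"] show ?thesis by simp
qed

section \<open>Positivity through the exponential series\<close>

lemma sum_in_nonneg_Reals:
  assumes "\<And>i. i \<in> I \<Longrightarrow> f i \<in> (\<real>\<^sub>\<ge>\<^sub>0 :: 'a::real_algebra_1 set)"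
  shows "(\<Sum>i\<in>I. f i) \<in> \<real>\<^sub>\<ge>\<^sub>0"
  using assms by (induction I rule: infinite_finite_induct) auto

text \<open>The partial sums of the exponential series have nonnegative integrals by
  \<open>nonneg\<close>. Dominated convergence carries this to the limit, since the nonnegative
  reals are closed.\<close>

lemma (in finite_measure) integral_exp_nonneg:
  assumes F: "bounded_measurable M F" and X: "bounded_measurable M X"
    and nonneg: "\<And>n. (\<integral>x. F x * X x ^ n \<partial>M) \<in> \<real>\<^sub>\<ge>\<^sub>0"
  shows "(\<integral>x. F x * exp (X x) \<partial>M) \<in> \<real>\<^sub>\<ge>\<^sub>0"
proof -
  obtain K where K: "\<And>x. x \<in> space M \<Longrightarrow> norm (F x) \<le> K"
    using F by (auto simp: bounded_measurable_def)
  obtain B where B: "\<And>x. x \<in> space M \<Longrightarrow> norm (X x) \<le> B"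
    using X by (auto simp: bounded_measurable_def)
  let ?S = "\<lambda>k x. \<Sum>n<k. X x ^ n /\<^sub>R fact n"
  note [bm_intros] = F X
  have bm: "bounded_measurable M (\<lambda>x. F x * ?S k x)" for k
    unfolding scaleR_conv_of_real by (intro bm_intros)
  \<comment> \<open>All partial sums are bounded in norm by \<open>exp (norm (X x))\<close>, hence
    by \<open>exp B\<close>, so a constant dominates.\<close>
  have lim: "(\<lambda>k. \<integral>x. F x * ?S k x \<partial>M) \<longlonglongrightarrow> (\<integral>x. F x * exp (X x) \<partial>M)"
  proof (rule integral_dominated_convergence[where w = "\<lambda>_. \<bar>K\<bar> * exp B"])
    show "AE x in M. (\<lambda>k. F x * ?S k x) \<longlonglongrightarrow> F x * exp (X x)"
      using exp_converges by (intro AE_I2 tendsto_mult tendsto_const) (simp add: sums_def)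
    show "AE x in M. norm (F x * ?S k x) \<le> \<bar>K\<bar> * exp B" for k
    proof (rule AE_I2)
      fix x assume x: "x \<in> space M"
      have "norm (?S k x) \<le> (\<Sum>n<k. norm (X x) ^ n /\<^sub>R fact n)"
        by (rule order.trans[OF norm_sum]) (simp add: norm_power)
      also have "\<dots> \<le> (\<Sum>n. norm (X x) ^ n /\<^sub>R fact n)"
        using exp_converges[of "norm (X x)"] by (intro sum_le_suminf) (auto simp: sums_iff)
      also have "\<dots> = exp (norm (X x))"
        using exp_converges[of "norm (X x)"] by (rule sums_unique[symmetric])
      also have "\<dots> \<le> exp B" using B[OF x] by simp
      finally show "norm (F x * ?S k x) \<le> \<bar>K\<bar> * exp B"
        using K[OF x] unfolding norm_mult by (intro mult_mono) auto
    qed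
    show "(\<lambda>x. F x * exp (X x)) \<in> borel_measurable M"
      by (intro bounded_measurableD bm_intros)
    show "(\<lambda>x. F x * ?S k x) \<in> borel_measurable M" for k
      by (rule bounded_measurableD[OF bm])
  qed simp
  have partial: "(\<integral>x. F x * ?S k x \<partial>M) \<in> \<real>\<^sub>\<ge>\<^sub>0" for k
  proof -
    have "(\<integral>x. F x * ?S k x \<partial>M) = (\<integral>x. (\<Sum>n<k. of_real (1 / fact n) * (F x * X x ^ n)) \<partial>M)"
      by (simp add: sum_distrib_left scaleR_conv_of_real divide_inverse mult_ac)
    also have "\<dots> = (\<Sum>n<k. of_real (1 / fact n) * (\<integral>x. F x * X x ^ n \<partial>M))"
      by (subst Bochner_Integration.integral_sum)
         (auto intro!: bounded_measurable_integrable bm_intros simp del: of_real_divide)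
    also have "\<dots> \<in> \<real>\<^sub>\<ge>\<^sub>0"
      using nonneg by (intro sum_in_nonneg_Reals nonneg_Reals_mult_I) (auto simp del: of_real_divide)
    finally show ?thesis .
  qed
  show ?thesis
    by (rule closed_sequentially[OF closed_nonneg_Reals_complex partial lim])
qed

section \<open>Gauge fixing\<close>

text \<open>Invariance under a global phase. The two configurations are related on \<open>V\<close>
  only, so the values outside \<open>V\<close> have no influence and updates and restrictions of
  extensional functions can be compared directly.\<close>

definition gauge_invariant :: "'v set \<Rightarrow> (('v \<Rightarrow> complex) \<Rightarrow> complex) \<Rightarrow> bool" where
  "gauge_invariant V h \<longleftrightarrow>
    (\<forall>\<zeta> \<sigma> \<tau>. norm \<zeta> = 1 \<longrightarrow> (\<forall>v\<in>V. \<tau> v = \<zeta> * \<sigma> v) \<longrightarrow> h \<tau> = h \<sigma>)"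

text \<open>Fubini isolates the spin \<open>y\<close> at \<open>c\<close>. Rotating all other spins
  by \<open>y\<close> preserves their measure and turns \<open>y\<close> into a global phase, which
  gauge invariance removes.\<close>

lemma integral_spin_measure_gauge_fix:
  assumes V: "finite V" and c: "c \<in> V" and inv: "gauge_invariant V h"
    and h: "bounded_measurable (spin_measure V) h"
    and h1: "bounded_measurable (spin_measure V) (\<lambda>\<sigma>. h (\<sigma>(c := 1)))"
  shows "(\<integral>\<sigma>. h \<sigma> \<partial>spin_measure V) = (\<integral>\<sigma>. h (\<sigma>(c := 1)) \<partial>spin_measure V)"
proof -
  define W where "W = V - {c}"
  have VW: "V = insert c W" "c \<notin> W" "finite W" using V c by (auto simp: W_def)
  interpret U: prob_space unif_circle by (rule prob_space_unif_circle)
  interpret product_sigma_finite "\<lambda>_. unif_circle" by standard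
  interpret W: prob_space "spin_measure W" by (rule prob_space_spin_measure)
  interpret P: pair_sigma_finite "spin_measure W" unif_circle ..
  interpret PP: prob_space "spin_measure W \<Otimes>\<^sub>M unif_circle"
    by (rule prob_space_pair) (rule prob_space_spin_measure prob_space_unif_circle)+
  have ins: "(\<integral>\<sigma>. k \<sigma> \<partial>spin_measure V) = (\<integral>x. (\<integral>y. k (x(c := y)) \<partial>unif_circle) \<partial>spin_measure W)"
    if "bounded_measurable (spin_measure V) k" for k :: "_ \<Rightarrow> complex"
    using integrable_spin_measure[OF that] VW unfolding spin_measure_def
    by (simp add: product_integral_insert)
  have upd: "(\<lambda>(x, y). x(c := y)) \<in> spin_measure W \<Otimes>\<^sub>M unif_circle \<rightarrow>\<^sub>M spin_measure V"
    unfolding VW(1) spin_measure_def by (rule measurable_add_dim)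
  have int: "integrable (spin_measure W \<Otimes>\<^sub>M unif_circle) (\<lambda>(x, y). h (x(c := y)))"
    using PP.bounded_measurable_integrable[OF bounded_measurable_compose[OF h upd]]
    by (simp add: case_prod_unfold)
  have rot: "(\<integral>x. h (x(c := y)) \<partial>spin_measure W) = (\<integral>x. h (x(c := 1)) \<partial>spin_measure W)"
    if y: "y \<in> space unif_circle" for y
  proof -
    have ny: "norm y = 1" using y by (simp add: space_unif_circle)
    have m: "(\<lambda>x. \<lambda>v\<in>W. y * x v) \<in> spin_measure W \<rightarrow>\<^sub>M spin_measure W"
      using ny by (intro measurable_spin_measureI borel_measurable_times spin_measurable)
        (auto simp: norm_mult norm_spin)
    have hm: "(\<lambda>x. h (x(c := y))) \<in> borel_measurable (spin_measure W)"
      using measurable_compose[OF measurable_Pair2'[OF y] measurable_compose[OF upd bounded_measurableD[OF h]]]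
      by simp
    have "(\<integral>x. h (x(c := y)) \<partial>spin_measure W) = (\<integral>x. h ((\<lambda>v\<in>W. y * x v)(c := y)) \<partial>spin_measure W)"
      using integral_distr[OF m hm] distr_spin_measure_rotate[OF VW(3), of "\<lambda>_. y"] ny by simp
    also have "\<dots> = (\<integral>x. h (x(c := 1)) \<partial>spin_measure W)"
      by (intro Bochner_Integration.integral_cong refl,
          rule inv[unfolded gauge_invariant_def, rule_format, OF ny]) (auto simp: VW(1))
    finally show ?thesis .
  qed
  have "(\<integral>\<sigma>. h \<sigma> \<partial>spin_measure V) = (\<integral>y. (\<integral>x. h (x(c := y)) \<partial>spin_measure W) \<partial>unif_circle)"
    unfolding ins[OF h] by (rule P.Fubini_integral[OF int, symmetric])
  also have "\<dots> = (\<integral>x. h (x(c := 1)) \<partial>spin_measure W)"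
    by (simp add: rot U.prob_space cong: Bochner_Integration.integral_cong)
  \<comment> \<open>The pinned integrand does not depend on the spin at \<open>c\<close>, so
    integrating over that spin multiplies by total mass 1.\<close>
  also have "\<dots> = (\<integral>\<sigma>. h (\<sigma>(c := 1)) \<partial>spin_measure V)"
    unfolding ins[OF h1] by (simp add: U.prob_space)
  finally show ?thesis .
qed

section \<open>Cones stable under multiplication by an edge interaction\<close>

abbreviation character_cone :: "'v set \<Rightarrow> (('v \<Rightarrow> complex) \<Rightarrow> complex) set" where
  "character_cone \<equiv> polynomial_cone (\<lambda>_ z. z) (\<lambda>_. cnj)"

lemma bounded_measurable_circle_id: "bounded_measurable unif_circle (\<lambda>z. z)"
  and bounded_measurable_circle_Re: "bounded_measurable unif_circle (\<lambda>z. of_real (Re z))"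
  and bounded_measurable_circle_Im: "bounded_measurable unif_circle (\<lambda>z. of_real (Im z))"
  by (rule bounded_measurableI[where B = 1];
      auto simp: space_unif_circle intro!: borel_measurable_unif_circle continuous_intros
        intro: order.trans[OF abs_Re_le_cmod] order.trans[OF abs_Im_le_cmod])+

lemma character_cone_bounded_measurable:
  "h \<in> character_cone V \<Longrightarrow> bounded_measurable (spin_measure V) h"
  by (erule bounded_measurable_polynomial_cone)
     (intro bm_intros bounded_measurable_circle_id)+

lemma integral_character_cone_nonneg:
  "finite V \<Longrightarrow> h \<in> character_cone V \<Longrightarrow> (\<integral>\<sigma>. h \<sigma> \<partial>spin_measure V) \<in> \<real>\<^sub>\<ge>\<^sub>0"
  by (erule integral_polynomial_cone_nonneg)
     (assumption | intro bm_intros bounded_measurable_circle_id integral_circle_character)+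

lemma edge_interaction_character_cone:
  assumes "finite_graph V E" "e \<in> E" "h \<in> character_cone V"
  shows "(\<lambda>\<sigma>. edge_interaction \<sigma> e * h \<sigma>) \<in> character_cone V"
proof -
  obtain u v where e: "u \<in> V" "v \<in> V" "u \<noteq> v" "e = {u, v}"
    using edge_cases[OF assms(1,2)] by blast
  have eq: "(\<lambda>\<sigma>. edge_interaction \<sigma> e * h \<sigma>)
      = (\<lambda>\<sigma>. \<sigma> u * (cnj (\<sigma> v) * h \<sigma>) + cnj (\<sigma> u) * (\<sigma> v * h \<sigma>))"
    using e by (simp add: edge_interaction_pair algebra_simps)
  show ?thesis
    unfolding eq by (intro polynomial_cone.intros assms e)
qed

lemma bounded_measurable_edge_interaction:
  assumes "finite_graph V E" "e \<in> E"
  shows "bounded_measurable (spin_measure V) (\<lambda>\<sigma>. edge_interaction \<sigma> e)"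
  using character_cone_bounded_measurable[OF edge_interaction_character_cone[OF assms polynomial_cone.one]]
  by simp

text \<open>The pinned spin at \<open>c\<close> has real part 1 and imaginary part 0.\<close>

abbreviation pinned_cone :: "'v \<Rightarrow> 'v set \<Rightarrow> (('v \<Rightarrow> complex) \<Rightarrow> complex) set" where
  "pinned_cone c \<equiv> polynomial_cone (\<lambda>v z. of_real (Re (if v = c then 1 else z)))
     (\<lambda>v z. of_real (Im (if v = c then 1 else z)))"

lemma pinned_cone_bounded_measurable:
  assumes "h \<in> pinned_cone c V"
  shows "bounded_measurable (spin_measure V) h"
proof (rule bounded_measurable_polynomial_cone[OF assms])
  fix v
  show "bounded_measurable unif_circle (\<lambda>z. of_real (Re (if v = c then 1 else z)))"
    "bounded_measurable unif_circle (\<lambda>z. of_real (Im (if v = c then 1 else z)))"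
    by (cases "v = c"; simp add: bm_intros bounded_measurable_circle_Re bounded_measurable_circle_Im)+
qed

lemma integral_pinned_cone_nonneg:
  assumes "finite V" "h \<in> pinned_cone c V"
  shows "(\<integral>\<sigma>. h \<sigma> \<partial>spin_measure V) \<in> \<real>\<^sub>\<ge>\<^sub>0"
proof (rule integral_polynomial_cone_nonneg[OF assms])
  interpret prob_space unif_circle by (rule prob_space_unif_circle)
  fix v
  show "bounded_measurable unif_circle (\<lambda>z. of_real (Re (if v = c then 1 else z)))"
    "bounded_measurable unif_circle (\<lambda>z. of_real (Im (if v = c then 1 else z)))"
    by (cases "v = c"; simp add: bm_intros bounded_measurable_circle_Re bounded_measurable_circle_Im)+
  fix p q
  show "(\<integral>z. of_real (Re (if v = c then 1 else z)) ^ p * of_real (Im (if v = c then 1 else z)) ^ q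
      \<partial>unif_circle) \<in> (\<real>\<^sub>\<ge>\<^sub>0 :: complex set)"
    \<comment> \<open>At the pinned site the integrand is the constant \<open>1 ^ p * 0 ^ q\<close>,
      which is 1 or 0.\<close>
    using integral_circle_Re_Im[of p q] by (cases "v = c") (simp_all add: prob_space power_0_left)
qed

text \<open>Positivity of coefficients becomes visible only after pinning, while gauge invariance is
  what permits pinning under the integral; both have to be carried through the expansion
  together.\<close>

definition gauge_cone :: "'v \<Rightarrow> 'v set \<Rightarrow> (('v \<Rightarrow> complex) \<Rightarrow> complex) set" where
  "gauge_cone c V = {h. bounded_measurable (spin_measure V) h \<and> gauge_invariant V h
     \<and> (\<lambda>\<sigma>. h (\<sigma>(c := 1))) \<in> pinned_cone c V}"

lemma integral_gauge_cone_nonneg: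
  assumes "finite V" "c \<in> V" "h \<in> gauge_cone c V"
  shows "(\<integral>\<sigma>. h \<sigma> \<partial>spin_measure V) \<in> \<real>\<^sub>\<ge>\<^sub>0"
proof -
  have h: "bounded_measurable (spin_measure V) h" "gauge_invariant V h"
    "(\<lambda>\<sigma>. h (\<sigma>(c := 1))) \<in> pinned_cone c V"
    using assms(3) by (auto simp: gauge_cone_def)
  show ?thesis
    unfolding integral_spin_measure_gauge_fix[OF assms(1,2) h(2,1) pinned_cone_bounded_measurable[OF h(3)]]
    by (rule integral_pinned_cone_nonneg[OF assms(1) h(3)])
qed

lemma unit_mult_cnj_unit:
  assumes "norm (\<zeta> :: complex) = 1"
  shows "(\<zeta> * x) * cnj (\<zeta> * y) = x * cnj y"
proof -
  have "\<zeta> * cnj \<zeta> = 1" using assms by (simp add: complex_norm_square[symmetric])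
  then show ?thesis by simp
qed

text \<open>An edge interaction is twice the cosine of an angle difference. The addition formula
  writes it as \<open>2 * (Re * Re + Im * Im)\<close>, which has positive coefficients after pinning
  and depends on the difference alone before.\<close>

lemma edge_interaction_gauge_cone:
  assumes G: "finite_graph V E" "e \<in> E" and h: "h \<in> gauge_cone c V"
  shows "(\<lambda>\<sigma>. edge_interaction \<sigma> e * h \<sigma>) \<in> gauge_cone c V"
proof -
  obtain u v where e: "u \<in> V" "v \<in> V" "u \<noteq> v" "e = {u, v}"
    using edge_cases[OF G] by blast
  have h': "bounded_measurable (spin_measure V) h" "gauge_invariant V h"
    "(\<lambda>\<sigma>. h (\<sigma>(c := 1))) \<in> pinned_cone c V"
    using h by (auto simp: gauge_cone_def)
  have "gauge_invariant V (\<lambda>\<sigma>. edge_interaction \<sigma> e)"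
    unfolding gauge_invariant_def
  proof (intro allI impI)
    fix \<zeta> :: complex and \<sigma> \<tau> :: "'a \<Rightarrow> complex"
    assume "norm \<zeta> = 1" "\<forall>v\<in>V. \<tau> v = \<zeta> * \<sigma> v"
    then have "\<tau> u * cnj (\<tau> v) = \<sigma> u * cnj (\<sigma> v)" "\<tau> v * cnj (\<tau> u) = \<sigma> v * cnj (\<sigma> u)"
      using e by (simp_all only: unit_mult_cnj_unit)
    then show "edge_interaction \<tau> e = edge_interaction \<sigma> e"
      using e by (simp add: edge_interaction_pair mult.commute)
  qed
  with h'(2) have inv: "gauge_invariant V (\<lambda>\<sigma>. edge_interaction \<sigma> e * h \<sigma>)"
    unfolding gauge_invariant_def by metis
  let ?h = "\<lambda>\<sigma>. h (\<sigma>(c := 1))"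
  let ?R = "\<lambda>\<sigma> v. complex_of_real (Re (if v = c then 1 else \<sigma> v))"
  let ?I = "\<lambda>\<sigma> v. complex_of_real (Im (if v = c then 1 else \<sigma> v))"
  \<comment> \<open>The factor 2 appears as a repeated summand, because the cone produces
    coefficients only through \<open>add\<close>.\<close>
  have eq: "(\<lambda>\<sigma>. edge_interaction (\<sigma>(c := 1)) e * ?h \<sigma>)
      = (\<lambda>\<sigma>. (?R \<sigma> u * (?R \<sigma> v * ?h \<sigma>) + ?I \<sigma> u * (?I \<sigma> v * ?h \<sigma>))
           + (?R \<sigma> u * (?R \<sigma> v * ?h \<sigma>) + ?I \<sigma> u * (?I \<sigma> v * ?h \<sigma>)))"
  proof
    fix \<sigma> :: "'a \<Rightarrow> complex"
    have "edge_interaction \<tau> e = 2 * (of_real (Re (\<tau> u)) * of_real (Re (\<tau> v)) + of_real (Im (\<tau> u)) * of_real (Im (\<tau> v)))"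
      for \<tau>
      using e by (simp add: edge_interaction_pair complex_eq_iff)
    then show "edge_interaction (\<sigma>(c := 1)) e * ?h \<sigma>
      = (?R \<sigma> u * (?R \<sigma> v * ?h \<sigma>) + ?I \<sigma> u * (?I \<sigma> v * ?h \<sigma>))
           + (?R \<sigma> u * (?R \<sigma> v * ?h \<sigma>) + ?I \<sigma> u * (?I \<sigma> v * ?h \<sigma>))"
      by (simp only: fun_upd_apply) (simp only: algebra_simps mult_2)
  qed
  have "(\<lambda>\<sigma>. edge_interaction (\<sigma>(c := 1)) e * ?h \<sigma>) \<in> pinned_cone c V"
    unfolding eq by (intro polynomial_cone.intros h' e)
  with inv h'(1) show ?thesis
    unfolding gauge_cone_def
    by (auto intro!: bounded_measurable_mult bounded_measurable_edge_interaction[OF G])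
qed

section \<open>Duplication\<close>

text \<open>Once the spin at \<open>c\<close> is 1, the two sines are the imaginary parts at
  \<open>a\<close> and \<open>b\<close>, so the product is a single monomial of the pinned
  cone.\<close>

lemma sine_product_gauge_cone:
  assumes V: "a \<in> V" "b \<in> V" "c \<in> V"
  shows "(\<lambda>\<sigma>. of_real (Im (\<sigma> a * cnj (\<sigma> c))) * of_real (Im (\<sigma> b * cnj (\<sigma> c)))) \<in> gauge_cone c V"
proof -
  let ?h = "\<lambda>\<sigma>. complex_of_real (Im (\<sigma> a * cnj (\<sigma> c))) * of_real (Im (\<sigma> b * cnj (\<sigma> c)))"
  \<comment> \<open>Writing \<open>Im\<close> through \<open>cnj\<close> puts the function within
    reach of the closure rules for \<open>bounded_measurable\<close>.\<close>
  have Im_eq: "complex_of_real (Im z) = (z - cnj z) * (- \<i> / 2)" for z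
    by (simp add: complex_eq_iff)
  have "bounded_measurable (spin_measure V) ?h"
    unfolding Im_eq by (intro bm_intros V)
  moreover have "gauge_invariant V ?h"
    using V unfolding gauge_invariant_def by (simp add: unit_mult_cnj_unit del: complex_cnj_mult)
  moreover have "(\<lambda>\<sigma>. ?h (\<sigma>(c := 1))) \<in> pinned_cone c V"
  proof -
    have eq: "(\<lambda>\<sigma>. ?h (\<sigma>(c := 1)))
        = (\<lambda>\<sigma>. of_real (Im (if a = c then 1 else \<sigma> a)) * (of_real (Im (if b = c then 1 else \<sigma> b)) * 1))"
      by auto
    show ?thesis unfolding eq by (intro polynomial_cone.intros V)
  qed
  ultimately show ?thesis by (simp add: gauge_cone_def)
qed

text \<open>In each power of the exponent every edge contributes one interaction in \<open>z\<close>
  and one in \<open>w\<close>. The former is absorbed into \<open>A\<close>, the latter into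
  \<open>B\<close>, and both cones are stable under this. What remains is a product of two
  nonnegative integrals.\<close>

lemma integral_character_gauge_exp_nonneg:
  assumes G: "finite_graph V E" and c: "c \<in> V" and \<kappa>: "0 \<le> \<kappa>"
    and A: "A \<in> character_cone V" and B: "B \<in> gauge_cone c V"
  shows "(\<integral>p. (A (snd p) * B (fst p)) *
      exp (\<Sum>e\<in>E. of_real \<kappa> * (edge_interaction (snd p) e * edge_interaction (fst p) e))
      \<partial>spin_measure2 V) \<in> \<real>\<^sub>\<ge>\<^sub>0"
proof -
  interpret prob_space "spin_measure2 V" by (rule prob_space_spin_measure2)
  have V: "finite V" using G by (simp add: finite_graph_def)
  let ?X = "\<lambda>p. \<Sum>e\<in>E. of_real \<kappa> * (edge_interaction (snd p) e * edge_interaction (fst p) e)"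
  have gc: "bounded_measurable (spin_measure V) B" if "B \<in> gauge_cone c V" for B
    using that by (simp add: gauge_cone_def)
  note [bm_intros] = bounded_measurable_edge_interaction[OF G] character_cone_bounded_measurable gc
  have X: "bounded_measurable (spin_measure2 V) ?X"
    by (intro bm_intros)
  have "(\<integral>p. (A (snd p) * B (fst p)) * ?X p ^ n \<partial>spin_measure2 V) \<in> \<real>\<^sub>\<ge>\<^sub>0" for n
    using A B
  proof (induction n arbitrary: A B)
    case 0
    have "(\<integral>p. A (snd p) * B (fst p) \<partial>spin_measure2 V)
        = (\<integral>\<sigma>. B \<sigma> \<partial>spin_measure V) * (\<integral>\<sigma>. A \<sigma> \<partial>spin_measure V)"
      using integral_spin_measure2_times[OF gc character_cone_bounded_measurable, OF 0(2,1)]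
      by (simp add: mult.commute)
    then show ?case
      using integral_gauge_cone_nonneg[OF V c 0(2)] integral_character_cone_nonneg[OF V 0(1)] by simp
  next
    case (Suc n)
    let ?A = "\<lambda>e \<sigma>. edge_interaction \<sigma> e * A \<sigma>" and ?B = "\<lambda>e \<sigma>. edge_interaction \<sigma> e * B \<sigma>"
    have AB: "?A e \<in> character_cone V" "?B e \<in> gauge_cone c V" if "e \<in> E" for e
      using edge_interaction_character_cone[OF G that Suc.prems(1)]
        edge_interaction_gauge_cone[OF G that Suc.prems(2)] by auto
    have eq: "(A (snd p) * B (fst p)) * ?X p ^ Suc n
        = (\<Sum>e\<in>E. of_real \<kappa> * ((?A e (snd p) * ?B e (fst p)) * ?X p ^ n))" for p
      unfolding power_Suc sum_distrib_left sum_distrib_right by (intro sum.cong refl) (simp only: mult_ac)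
    have bm: "bounded_measurable (spin_measure2 V) (\<lambda>p. (?A e (snd p) * ?B e (fst p)) * ?X p ^ n)"
      if "e \<in> E" for e
      using that Suc.prems by (intro bm_intros)
    have "(\<integral>p. (A (snd p) * B (fst p)) * ?X p ^ Suc n \<partial>spin_measure2 V)
        = (\<Sum>e\<in>E. of_real \<kappa> * (\<integral>p. (?A e (snd p) * ?B e (fst p)) * ?X p ^ n \<partial>spin_measure2 V))"
      unfolding eq using bm
      by (subst Bochner_Integration.integral_sum)
         (auto intro!: integrable_spin_measure2 bounded_measurable_mult[OF bounded_measurable_const])
    also have "\<dots> \<in> \<real>\<^sub>\<ge>\<^sub>0"
    proof (rule sum_in_nonneg_Reals)
      fix e assume "e \<in> E"
      then have "(\<integral>p. (?A e (snd p) * ?B e (fst p)) * ?X p ^ n \<partial>spin_measure2 V) \<in> \<real>\<^sub>\<ge>\<^sub>0"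
        by (intro Suc.IH AB)
      then show "of_real \<kappa> * (\<integral>p. (?A e (snd p) * ?B e (fst p)) * ?X p ^ n \<partial>spin_measure2 V) \<in> \<real>\<^sub>\<ge>\<^sub>0"
        using \<kappa> by simp
    qed
    finally show ?case .
  qed
  then show ?thesis
    by (intro integral_exp_nonneg X bm_intros A B)
qed

section \<open>The Gibbs weight of the duplicated model in half angles\<close>

lemma xy_weight_eq_exp:
  assumes "finite_graph V E"
  shows "complex_of_real (xy_weight E \<beta> \<sigma>) = exp (\<Sum>e\<in>E. of_real (\<beta> / 2) * edge_interaction \<sigma> e)"
proof -
  have "(\<Sum>e\<in>E. edge_interaction \<sigma> e) \<in> \<real>"
    using edge_interaction_real[OF assms] by (intro sum_in_Reals)
  then have "complex_of_real (Re (\<Sum>e\<in>E. edge_interaction \<sigma> e)) = (\<Sum>e\<in>E. edge_interaction \<sigma> e)"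
    by (rule of_real_Re)
  then show ?thesis
    unfolding xy_weight_def exp_of_real[symmetric] sum_distrib_left[symmetric] of_real_mult by simp
qed

text \<open>This is \<open>cos (x - y) + cos (x + y) = 2 * cos x * cos y\<close>, doubled, for the
  angle differences \<open>x\<close> of \<open>z\<close> and \<open>y\<close> of \<open>w\<close>
  along the edge.\<close>

lemma edge_interaction_half_angle:
  assumes "finite_graph V E" "e \<in> E"
  shows "edge_interaction (fst (half_angle V p)) e + edge_interaction (snd (half_angle V p)) e
    = edge_interaction (snd p) e * edge_interaction (fst p) e"
proof -
  obtain u v where e: "u \<in> V" "v \<in> V" "u \<noteq> v" "e = {u, v}"
    using edge_cases[OF assms] by blast
  then show ?thesis
    by (simp add: edge_interaction_pair half_angle_def case_prod_beta algebra_simps)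
qed

lemma xy_weight_half_angle:
  assumes G: "finite_graph V E"
  shows "complex_of_real (xy_weight E \<beta> (fst (half_angle V p))) * of_real (xy_weight E \<beta> (snd (half_angle V p)))
    = exp (\<Sum>e\<in>E. of_real (\<beta> / 2) * (edge_interaction (snd p) e * edge_interaction (fst p) e))"
  unfolding xy_weight_eq_exp[OF G] exp_add[symmetric] sum.distrib[symmetric] distrib_left[symmetric]
  by (simp add: edge_interaction_half_angle[OF G] cong: sum.cong)

lemma bounded_measurable_xy_weight:
  assumes "finite_graph V E"
  shows "bounded_measurable (spin_measure V) (\<lambda>\<sigma>. complex_of_real (xy_weight E \<beta> \<sigma>))"
  unfolding xy_weight_eq_exp[OF assms]
  by (intro bm_intros bounded_measurable_edge_interaction[OF assms])

lemma xy_expectation_eq: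
  assumes G: "finite_graph V E" and f: "bounded_measurable (spin_measure V) f"
  shows "xy_expectation V E \<beta> f = (\<integral>\<sigma>. of_real (xy_weight E \<beta> \<sigma>) * f \<sigma> \<partial>spin_measure V)
    / of_real (xy_partition V E \<beta>)"
proof -
  let ?w = "\<lambda>\<sigma>. xy_weight E \<beta> \<sigma> / xy_partition V E \<beta>"
  note [measurable] = xy_weight_measurable[OF G] bounded_measurableD[OF f]
  have "xy_expectation V E \<beta> f = (\<integral>\<sigma>. ?w \<sigma> *\<^sub>R f \<sigma> \<partial>spin_measure V)"
    unfolding xy_expectation_def xy_measure_def
    using xy_partition_pos[OF G] xy_weight_pos[THEN less_imp_le]
    by (intro integral_density AE_I2 divide_nonneg_pos) auto
  also have "\<dots> = (\<integral>\<sigma>. (of_real (xy_weight E \<beta> \<sigma>) * f \<sigma>) / of_real (xy_partition V E \<beta>) \<partial>spin_measure V)"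
    by (simp add: scaleR_conv_of_real)
  finally show ?thesis by simp
qed

text \<open>The common core of both inequalities. Exchanging the two copies does not change the
  product measure, so the difference may be symmetrised; only the symmetrised integrand splits into
  a function of \<open>z\<close> times a function of \<open>w\<close>.\<close>

lemma xy_duplicate_nonneg:
  assumes G: "finite_graph V E" and \<beta>: "\<beta> > 0" and c: "c \<in> V"
    and f: "bounded_measurable (spin_measure V) f1" "bounded_measurable (spin_measure V) f2"
      "bounded_measurable (spin_measure V) g1" "bounded_measurable (spin_measure V) g2"
    and A: "A \<in> character_cone V" and B: "B \<in> gauge_cone c V"
    and eq: "\<And>p. p \<in> space (spin_measure2 V) \<Longrightarrow>
      f1 (fst (half_angle V p)) * f2 (snd (half_angle V p))
      + f2 (fst (half_angle V p)) * f1 (snd (half_angle V p))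
      - g1 (fst (half_angle V p)) * g2 (snd (half_angle V p))
      - g2 (fst (half_angle V p)) * g1 (snd (half_angle V p)) = 4 * (A (snd p) * B (fst p))"
  shows "xy_expectation V E \<beta> f1 * xy_expectation V E \<beta> f2
    - xy_expectation V E \<beta> g1 * xy_expectation V E \<beta> g2 \<in> \<real>\<^sub>\<ge>\<^sub>0"
proof -
  let ?w = "\<lambda>\<sigma>. complex_of_real (xy_weight E \<beta> \<sigma>)" and ?Z = "complex_of_real (xy_partition V E \<beta>)"
  let ?I = "\<lambda>f. \<integral>\<sigma>. ?w \<sigma> * f \<sigma> \<partial>spin_measure V"
  let ?T = "\<lambda>f g p. (?w (fst p) * f (fst p)) * (?w (snd p) * g (snd p))"
  let ?F = "\<lambda>p. ?T f1 f2 p + ?T f2 f1 p - ?T g1 g2 p - ?T g2 g1 p"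
  have V: "finite V" using G by (simp add: finite_graph_def)
  note [bm_intros] = bounded_measurable_xy_weight[OF G] f
  have T: "(\<integral>p. ?T f g p \<partial>spin_measure2 V) = ?I f * ?I g" "integrable (spin_measure2 V) (?T f g)"
    if "bounded_measurable (spin_measure V) f" "bounded_measurable (spin_measure V) g" for f g
  proof -
    note [bm_intros] = that
    show "(\<integral>p. ?T f g p \<partial>spin_measure2 V) = ?I f * ?I g"
      by (rule integral_spin_measure2_times) (intro bm_intros)+
    show "integrable (spin_measure2 V) (?T f g)"
      by (intro integrable_spin_measure2 bm_intros)
  qed
  \<comment> \<open>The factor 2 comes from the symmetrisation: \<open>?T f g\<close> and
    \<open>?T g f\<close> have the same integral.\<close>
  have "2 * (?I f1 * ?I f2 - ?I g1 * ?I g2) = (\<integral>p. ?F p \<partial>spin_measure2 V)"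
    by (simp add: T f)
  also have "\<dots> = (\<integral>p. ?F (half_angle V p) \<partial>spin_measure2 V)"
    by (intro integral_spin_measure2_half_angle V bm_intros)
  also have "\<dots> = (\<integral>p. 4 * ((A (snd p) * B (fst p)) *
      exp (\<Sum>e\<in>E. of_real (\<beta> / 2) * (edge_interaction (snd p) e * edge_interaction (fst p) e)))
      \<partial>spin_measure2 V)"
  proof (rule Bochner_Integration.integral_cong[OF refl])
    fix p assume p: "p \<in> space (spin_measure2 V)"
    let ?p = "half_angle V p"
    have "?F ?p = (f1 (fst ?p) * f2 (snd ?p) + f2 (fst ?p) * f1 (snd ?p)
        - g1 (fst ?p) * g2 (snd ?p) - g2 (fst ?p) * g1 (snd ?p)) * (?w (fst ?p) * ?w (snd ?p))"
      by (simp add: algebra_simps)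
    then show "?F ?p = 4 * ((A (snd p) * B (fst p)) *
        exp (\<Sum>e\<in>E. of_real (\<beta> / 2) * (edge_interaction (snd p) e * edge_interaction (fst p) e)))"
      unfolding eq[OF p] xy_weight_half_angle[OF G] by (simp only: mult.assoc)
  qed
  also have "\<dots> = 4 * (\<integral>p. (A (snd p) * B (fst p)) *
      exp (\<Sum>e\<in>E. of_real (\<beta> / 2) * (edge_interaction (snd p) e * edge_interaction (fst p) e))
      \<partial>spin_measure2 V)"
    by (rule integral_mult_right_zero)
  also have "\<dots> \<in> \<real>\<^sub>\<ge>\<^sub>0"
    using \<beta> by (intro nonneg_Reals_mult_I integral_character_gauge_exp_nonneg[OF G c _ A B]) auto
  finally have "2 * (?I f1 * ?I f2 - ?I g1 * ?I g2) / 2 \<in> \<real>\<^sub>\<ge>\<^sub>0"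
    by (rule nonneg_Reals_divide_I) simp
  then have nonneg: "?I f1 * ?I f2 - ?I g1 * ?I g2 \<in> \<real>\<^sub>\<ge>\<^sub>0"
    by (simp only: nonzero_mult_div_cancel_left[OF zero_neq_numeral[symmetric]])
  have "xy_expectation V E \<beta> f1 * xy_expectation V E \<beta> f2
      - xy_expectation V E \<beta> g1 * xy_expectation V E \<beta> g2 = (?I f1 * ?I f2 - ?I g1 * ?I g2) / (?Z * ?Z)"
    by (simp add: xy_expectation_eq[OF G] f diff_divide_distrib)
  also have "\<dots> \<in> \<real>\<^sub>\<ge>\<^sub>0"
    using nonneg xy_partition_pos[OF G, of \<beta>] by (intro nonneg_Reals_divide_I nonneg_Reals_mult_I) auto
  finally show ?thesis .
qed

section \<open>The algebraic identities behind the two inequalities\<close>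

text \<open>Each factor \<open>x - cnj x\<close> is \<open>2 * \<i>\<close> times the imaginary
  part, and the two factors \<open>2 * \<i>\<close> multiply to -4.\<close>

lemma four_mult_Im_mult_Im:
  "4 * (A * (complex_of_real (Im x) * of_real (Im y))) = A * - ((x - cnj x) * (y - cnj y))"
proof -
  have "4 * (complex_of_real (Im x) * of_real (Im y)) = - ((x - cnj x) * (y - cnj y))"
    by (simp add: complex_eq_iff)
  then show ?thesis by (metis mult.left_commute)
qed

text \<open>Primed variables stand for conjugates, with unimodularity as a separate equation, which
  makes this an identity in a commutative ring. The factor \<open>zc * zc'\<close> cancels from the
  subtracted terms, and \<open>xc * xc'\<close> is inserted into the others to complete the product
  of the two differences.\<close>

lemma half_angle_difference:
  fixes xa xa' xb xb' xc xc' za zb zc zc' :: "'a :: comm_ring_1"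
  assumes x: "xc * xc' = 1" and z: "zc * zc' = 1"
  shows "za * xa' * (zb * xb) + za * xa * (zb * xb')
      - za * xa' * (zc' * xc) * (zc * xc * (zb * xb')) - zc * xc' * (zb * xb) * (za * xa * (zc' * xc'))
    = za * zb * - ((xa * xc' - xa' * xc) * (xb * xc' - xb' * xc))"
proof -
  have "za * xa' * (zb * xb) + za * xa * (zb * xb')
      - za * xa' * (zc' * xc) * (zc * xc * (zb * xb')) - zc * xc' * (zb * xb) * (za * xa * (zc' * xc'))
    = za * zb * (xa' * xb + xa * xb' - (zc * zc') * (xa' * xb' * xc\<^sup>2 + xa * xb * xc'\<^sup>2))"
    by (simp add: algebra_simps power2_eq_square)
  also have "\<dots> = za * zb * ((xc * xc') * (xa' * xb + xa * xb') - (xa' * xb' * xc\<^sup>2 + xa * xb * xc'\<^sup>2))"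
    by (simp add: x z)
  also have "\<dots> = za * zb * - ((xa * xc' - xa' * xc) * (xb * xc' - xb' * xc))"
    by (simp add: algebra_simps power2_eq_square)
  finally show ?thesis .
qed

text \<open>Every term contains \<open>za * zb\<close> and the square of \<open>zc'\<close>; the
  remaining factors are the expanded product of the two differences.\<close>

lemma half_angle_sum:
  fixes xa xa' xb xb' xc xc' za zb zc' :: "'a :: comm_ring_1"
  assumes x: "xc * xc' = 1"
  shows "za * xa' * (zc' * xc) * (zb * xb * (zc' * xc')) + zb * xb' * (zc' * xc) * (za * xa * (zc' * xc'))
      - za * xa' * (zb * xb') * (zc' * xc)\<^sup>2 - za * xa * (zb * xb) * (zc' * xc')\<^sup>2
    = za * zb * zc'\<^sup>2 * - ((xa * xc' - xa' * xc) * (xb * xc' - xb' * xc))"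
  by (simp add: algebra_simps power2_eq_square)

theorem lemma19:
  fixes V :: "'v set" and E :: "'v set set" and \<beta> :: real and a b c :: 'v
  assumes "finite_graph V E"
    and "\<beta> > 0"
    and "a \<in> V" and "b \<in> V" and "c \<in> V"
  shows "Re (xy_expectation V E \<beta> (\<lambda>\<sigma>. \<sigma> a * cnj (\<sigma> b)))
           \<ge> Re (xy_expectation V E \<beta> (\<lambda>\<sigma>. \<sigma> a * cnj (\<sigma> c)))
             * Re (xy_expectation V E \<beta> (\<lambda>\<sigma>. \<sigma> c * cnj (\<sigma> b)))
       \<and> Re (xy_expectation V E \<beta> (\<lambda>\<sigma>. \<sigma> a * cnj (\<sigma> c)))
           * Re (xy_expectation V E \<beta> (\<lambda>\<sigma>. \<sigma> c * cnj (\<sigma> b)))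
           \<ge> Re (xy_expectation V E \<beta> (\<lambda>\<sigma>. \<sigma> a * \<sigma> b * cnj (\<sigma> c) ^ 2))"
proof -
  note G = assms(1) and \<beta> = assms(2) and V = assms(3-5)
  let ?E = "xy_expectation V E \<beta>"
  let ?ab = "\<lambda>\<sigma>. \<sigma> a * cnj (\<sigma> b)" and ?ac = "\<lambda>\<sigma>. \<sigma> a * cnj (\<sigma> c)"
    and ?cb = "\<lambda>\<sigma>. \<sigma> c * cnj (\<sigma> b)" and ?bc = "\<lambda>\<sigma>. \<sigma> b * cnj (\<sigma> c)"
    and ?abcc = "\<lambda>\<sigma>. \<sigma> a * \<sigma> b * cnj (\<sigma> c) ^ 2"
  let ?B = "\<lambda>\<sigma>. complex_of_real (Im (\<sigma> a * cnj (\<sigma> c))) * of_real (Im (\<sigma> b * cnj (\<sigma> c)))"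
  have B: "?B \<in> gauge_cone c V"
    by (rule sine_product_gauge_cone[OF V])
  have unit: "fst p v * cnj (fst p v) = 1" "snd p v * cnj (snd p v) = 1"
    if "p \<in> space (spin_measure2 V)" "v \<in> V" for p v
    using that by (auto simp: space_pair_measure norm_spin complex_norm_square[symmetric])
  \<comment> \<open>A single correlation is treated as a product with the expectation of 1, so that
    both sides of each inequality are quadratic in expectations.\<close>
  have one: "?E (\<lambda>_. 1) = 1"
    using prob_space.prob_space[OF prob_space_xy_measure[OF G]] by (simp add: xy_expectation_def)
  have real: "?E ?ac \<in> \<real>" "?E ?cb \<in> \<real>"
    by (rule xy_correlations_real[OF G]; use V in simp)+
  \<comment> \<open>The second duplication produces the conjugate of the correlation in the
    statement; by reality the two agree.\<close>
  have "?E ?bc = ?E (\<lambda>\<sigma>. cnj (?cb \<sigma>))"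
    by (simp add: mult.commute)
  also have "\<dots> = cnj (?E ?cb)"
    unfolding xy_expectation_def by (rule Bochner_Integration.integral_cnj)
  also have "\<dots> = ?E ?cb"
    using real(2) by (simp only: Reals_cnj_iff)
  finally have bc: "?E ?bc = ?E ?cb" .
  \<comment> \<open>First inequality: the \<open>z\<close>-part is \<open>?ab\<close>, and the two
    sines form the \<open>w\<close>-part \<open>?B\<close>.\<close>
  have "?E ?ab * ?E (\<lambda>_. 1) - ?E ?ac * ?E ?cb \<in> \<real>\<^sub>\<ge>\<^sub>0"
  proof (rule xy_duplicate_nonneg[OF G \<beta> V(3) _ _ _ _ _ B])
    have "(\<lambda>\<sigma>. \<sigma> a * (cnj (\<sigma> b) * 1)) \<in> character_cone V"
      by (intro polynomial_cone.intros V)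
    then show "?ab \<in> character_cone V" by simp
    fix p assume p: "p \<in> space (spin_measure2 V)"
    show "?ab (fst (half_angle V p)) * 1 + 1 * ?ab (snd (half_angle V p))
        - ?ac (fst (half_angle V p)) * ?cb (snd (half_angle V p))
        - ?cb (fst (half_angle V p)) * ?ac (snd (half_angle V p)) = 4 * (?ab (snd p) * ?B (fst p))"
      \<comment> \<open>The role of \<open>zb\<close> is played by the conjugate
        \<open>cnj (snd p b)\<close>, since the spin at \<open>b\<close> enters \<open>?ab\<close>
        conjugated.\<close>
      using half_angle_difference[OF unit[OF p V(3)], of "snd p a" "cnj (fst p a)" "cnj (snd p b)" "fst p b" "fst p a" "cnj (fst p b)"] V
      unfolding four_mult_Im_mult_Im
      by (simp add: half_angle_def case_prod_beta)
  qed (intro bm_intros V)+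
  \<comment> \<open>Second inequality: the same \<open>w\<close>-part \<open>?B\<close>, now with
    \<open>?abcc\<close> as the \<open>z\<close>-part.\<close>
  moreover have "?E ?ac * ?E ?bc - ?E ?abcc * ?E (\<lambda>_. 1) \<in> \<real>\<^sub>\<ge>\<^sub>0"
  proof (rule xy_duplicate_nonneg[OF G \<beta> V(3) _ _ _ _ _ B])
    have "(\<lambda>\<sigma>. \<sigma> a * (\<sigma> b * (cnj (\<sigma> c) * (cnj (\<sigma> c) * 1)))) \<in> character_cone V"
      by (intro polynomial_cone.intros V)
    then show "?abcc \<in> character_cone V" by (simp add: power2_eq_square mult.assoc)
    fix p assume p: "p \<in> space (spin_measure2 V)"
    show "?ac (fst (half_angle V p)) * ?bc (snd (half_angle V p))
        + ?bc (fst (half_angle V p)) * ?ac (snd (half_angle V p))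
        - ?abcc (fst (half_angle V p)) * 1 - 1 * ?abcc (snd (half_angle V p)) = 4 * (?abcc (snd p) * ?B (fst p))"
      using half_angle_sum[OF unit(1)[OF p V(3)], of "snd p a" "cnj (fst p a)" "cnj (snd p c)" "snd p b" "fst p b" "cnj (fst p b)" "fst p a"] V
      unfolding four_mult_Im_mult_Im
      by (simp add: half_angle_def case_prod_beta)
  qed (intro bm_intros V)+
  \<comment> \<open>For real correlations the real part of a product is the product of the real
    parts.\<close>
  ultimately show ?thesis
    using real unfolding bc one complex_nonneg_Reals_iff complex_is_Real_iff by simp
qed

end
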